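(* Let $A$ be a noetherian (locally finite) $\mathbb{N}$-graded algebra over a field $k$ such that $A_0$ is semisimple and $A$ has a balanced dualizing complex. Then for every $0\neq X\in\mathbf{D}^+_{fg}(\mathrm{Gr}\,A)$, $$\mathrm{CMreg}(X)=\mathrm{Ex\text{-}reg}(X).$$
   Context: $k$ is a field. An $\mathbb{N}$-graded algebra $A=\bigoplus_{i\geqslant 0}A_i$ is always a $k$-algebra that is locally finite: $\dim_k A_i<\infty$ for all $i$. Noetherian means left and right noetherian. $A^o$ is the opposite algebra, $A^e=A\otimes_k A^o$. Modules are graded left modules. $\mathrm{Gr}\,A$ is the category of graded $A$-modules with degree-zero morphisms. $\mathbf{D}^+_{fg}(\mathrm{Gr}\,A)$ is the derived category of left bounded (bounded below) cochain complexes with finitely generated cohomologies. $J$ is the graded Jacobson radical of $A$ and $S=A/J$ (so $S=A_0$ here). Shift: $M(j)_m=M_{m+j}$. $\underline{\mathrm{Hom}}_A(M,N)=\bigoplus_j\mathrm{Hom}_{\mathrm{Gr}\,A}(M,N(j))$, with derived functor $R\underline{\mathrm{Hom}}_A$. $\mathrm{D}(-)=\underline{\mathrm{Hom}}_k(-,k)$ is the graded (Matlis) dual. For a graded module $M$, $\Gamma_A(M)=\{m\in M\mid A_{\geqslant i}m=0 \text{ for } i\gg 0\}$; $R\Gamma_A$ is its right derived functor; similarly $R\Gamma_{A^o}$. A balanced dualizing complex of $A$ is a complex $R\in\mathbf{D}^b(\mathrm{Gr}\,A^e)$ such that: $R$ has finite injective dimension over $A$ and over $A^o$; its cohomologies are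 finitely generated over $A$ and over $A^o$; the natural morphisms $A\to R\underline{\mathrm{Hom}}_A(R,R)$ and $A\to R\underline{\mathrm{Hom}}_{A^o}(R,R)$ are isomorphisms in $\mathbf{D}(\mathrm{Gr}\,A^e)$; and $R\Gamma_A(R)\cong\mathrm{D}(A)\cong R\Gamma_{A^o}(R)$ in $\mathbf{D}(\mathrm{Gr}\,A^e)$. For a complex $X$ of graded modules or graded vector spaces, $\mathrm{sup.deg}(X)=\sup\{i+j\mid H^i(X)_j\neq 0\}\in\mathbb{Z}\cup\{\pm\infty\}$. For $X\in\mathbf{D}^+(\mathrm{Gr}\,A)$: $\mathrm{CMreg}(X)=\mathrm{sup.deg}(R\Gamma_A(X))$ and $\mathrm{Ex\text{-}reg}(X)=\mathrm{sup.deg}(R\underline{\mathrm{Hom}}_A(S,X))$. *)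

theory Defs
  imports "HOL-Algebra.Module" "HOL-Algebra.AbelCoset" "HOL-Library.FuncSet"
    "HOL-Library.Extended_Real"
begin

section \<open>Graded algebras\<close>

record ('k, 'a) gralg = "('k, 'a) module" +
  gpart :: "nat \<Rightarrow> 'a set"

definition is_decomp :: "('k, 'a) gralg \<Rightarrow> 'a \<Rightarrow> (nat \<Rightarrow> 'a) \<Rightarrow> bool" where
  "is_decomp A x f \<longleftrightarrow>
     (\<forall>i. f i \<in> gpart A i) \<and> finite {i. f i \<noteq> \<zero>\<^bsub>A\<^esub>} \<and> x = finsum A f {i. f i \<noteq> \<zero>\<^bsub>A\<^esub>}"

definition graded_algebra :: "'k ring \<Rightarrow> ('k, 'a) gralg \<Rightarrow> bool" where
  "graded_algebra K A \<longleftrightarrow>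
     field K \<and> ring A \<and> Module.module K A \<and>
     (\<forall>c\<in>carrier K. \<forall>x\<in>carrier A. \<forall>y\<in>carrier A.
        (c \<odot>\<^bsub>A\<^esub> x) \<otimes>\<^bsub>A\<^esub> y = c \<odot>\<^bsub>A\<^esub> (x \<otimes>\<^bsub>A\<^esub> y) \<and>
        x \<otimes>\<^bsub>A\<^esub> (c \<odot>\<^bsub>A\<^esub> y) = c \<odot>\<^bsub>A\<^esub> (x \<otimes>\<^bsub>A\<^esub> y)) \<and>
     (\<forall>i. submodule (gpart A i) K A) \<and>
     (\<forall>x\<in>carrier A. \<exists>!f. is_decomp A x f) \<and>
     \<one>\<^bsub>A\<^esub> \<in> gpart A 0 \<and>
     (\<forall>i j. \<forall>x\<in>gpart A i. \<forall>y\<in>gpart A j. x \<otimes>\<^bsub>A\<^esub> y \<in> gpart A (i + j))"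

definition locally_finite :: "'k ring \<Rightarrow> ('k, 'a) gralg \<Rightarrow> bool" where
  "locally_finite K A \<longleftrightarrow>
     (\<forall>i. \<exists>B. finite B \<and> B \<subseteq> gpart A i \<and>
        (\<forall>N. submodule N K A \<and> B \<subseteq> N \<longrightarrow> gpart A i \<subseteq> N))"

definition opp :: "('k, 'a) gralg \<Rightarrow> ('k, 'a) gralg" where
  "opp A = A\<lparr>mult := \<lambda>x y. y \<otimes>\<^bsub>A\<^esub> x\<rparr>"

definition left_ideal :: "('a, 'r) ring_scheme \<Rightarrow> 'a set \<Rightarrow> bool" where
  "left_ideal R L \<longleftrightarrow>
     additive_subgroup L R \<and> (\<forall>a\<in>carrier R. \<forall>x\<in>L. a \<otimes>\<^bsub>R\<^esub> x \<in> L)"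

definition left_noetherian :: "('a, 'r) ring_scheme \<Rightarrow> bool" where
  "left_noetherian R \<longleftrightarrow>
     (\<forall>L. left_ideal R L \<longrightarrow>
        (\<exists>B. finite B \<and> B \<subseteq> L \<and> (\<forall>L'. left_ideal R L' \<and> B \<subseteq> L' \<longrightarrow> L \<subseteq> L')))"

definition semisimple_ring :: "('a, 'r) ring_scheme \<Rightarrow> bool" where
  "semisimple_ring R \<longleftrightarrow>
     (\<forall>L. left_ideal R L \<longrightarrow>
        (\<exists>L'. left_ideal R L' \<and> L \<inter> L' = {\<zero>\<^bsub>R\<^esub>} \<and> L <+>\<^bsub>R\<^esub> L' = carrier R))"

definition graded_left_ideal :: "('k, 'a) gralg \<Rightarrow> 'a set \<Rightarrow> bool" where
  "graded_left_ideal A L \<longleftrightarrow>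
     left_ideal A L \<and> (\<forall>x\<in>L. \<forall>f. is_decomp A x f \<longrightarrow> (\<forall>i. f i \<in> L))"

definition maximal_graded_left_ideal :: "('k, 'a) gralg \<Rightarrow> 'a set \<Rightarrow> bool" where
  "maximal_graded_left_ideal A L \<longleftrightarrow>
     graded_left_ideal A L \<and> L \<noteq> carrier A \<and>
     (\<forall>L'. graded_left_ideal A L' \<and> L \<subseteq> L' \<longrightarrow> L' = L \<or> L' = carrier A)"

definition graded_Jacobson :: "('k, 'a) gralg \<Rightarrow> 'a set" where
  "graded_Jacobson A = carrier A \<inter> \<Inter>{L. maximal_graded_left_ideal A L}"

section \<open>Graded modules\<close>

text \<open>
  A graded module $\bigoplus_j M_j$ is given by the family of its homogeneous components, each an
  abelian group (only the additive part of the HOL-Algebra ring record is used), together with the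
  action of homogeneous operators: \<open>gact M i j a\<close> is the action $M_j \to M_{j+i}$ of an
  operator \<open>a\<close> of degree \<open>i\<close>. The degrees are arguments because the zero element of the algebra
  lies in every homogeneous part. For left and right modules the operators are the elements of
  the algebra; for bimodules they are \<open>Inl a\<close> (left multiplication by \<open>a\<close>) and \<open>Inr a\<close> (right
  multiplication by \<open>a\<close>). A parameter \<open>G :: nat \<Rightarrow> 'o set\<close> below is the family of
  homogeneous operators, and a parameter \<open>Ob\<close> singles out the objects of the category
  considered.
\<close>

record ('o, 'm) grmod =
  gcomp :: "int \<Rightarrow> 'm ring"
  gact :: "nat \<Rightarrow> int \<Rightarrow> 'o \<Rightarrow> 'm \<Rightarrow> 'm"

definition mk_grp :: "'m set \<Rightarrow> 'm \<Rightarrow> ('m \<Rightarrow> 'm \<Rightarrow> 'm) \<Rightarrow> 'm ring" where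
  "mk_grp S z f = \<lparr>carrier = S, mult = undefined, one = undefined, zero = z, add = f\<rparr>"

abbreviation el :: "('o, 'm) grmod \<Rightarrow> int \<Rightarrow> 'm set" where
  "el M j \<equiv> carrier (gcomp M j)"

definition graded_module :: "('k, 'a) gralg \<Rightarrow> ('a, 'm) grmod \<Rightarrow> bool" where
  "graded_module A M \<longleftrightarrow>
     (\<forall>j. abelian_group (gcomp M j)) \<and>
     (\<forall>i j. \<forall>a\<in>gpart A i. \<forall>x\<in>el M j. gact M i j a x \<in> el M (j + int i)) \<and>
     (\<forall>i j. \<forall>a\<in>gpart A i. \<forall>x\<in>el M j. \<forall>y\<in>el M j.
        gact M i j a (x \<oplus>\<^bsub>gcomp M j\<^esub> y)
          = gact M i j a x \<oplus>\<^bsub>gcomp M (j + int i)\<^esub> gact M i j a y) \<and>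
     (\<forall>i j. \<forall>a\<in>gpart A i. \<forall>b\<in>gpart A i. \<forall>x\<in>el M j.
        gact M i j (a \<oplus>\<^bsub>A\<^esub> b) x
          = gact M i j a x \<oplus>\<^bsub>gcomp M (j + int i)\<^esub> gact M i j b x) \<and>
     (\<forall>i i' j. \<forall>a\<in>gpart A i. \<forall>b\<in>gpart A i'. \<forall>x\<in>el M j.
        gact M (i + i') j (a \<otimes>\<^bsub>A\<^esub> b) x = gact M i (j + int i') a (gact M i' j b x)) \<and>
     (\<forall>j. \<forall>x\<in>el M j. gact M 0 j \<one>\<^bsub>A\<^esub> x = x)"

definition left_part :: "('a + 'a, 'm) grmod \<Rightarrow> ('a, 'm) grmod" where
  "left_part M = \<lparr>gcomp = gcomp M, gact = (\<lambda>i j a. gact M i j (Inl a))\<rparr>"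

definition right_part :: "('a + 'a, 'm) grmod \<Rightarrow> ('a, 'm) grmod" where
  "right_part M = \<lparr>gcomp = gcomp M, gact = (\<lambda>i j a. gact M i j (Inr a))\<rparr>"

text \<open>
  Graded modules over $A^e = A \otimes_k A^o$ are graded bimodules on which \<open>k\<close> acts centrally:
  $(a \otimes b) x = a x b$.
\<close>

definition graded_bimodule :: "'k ring \<Rightarrow> ('k, 'a) gralg \<Rightarrow> ('a + 'a, 'm) grmod \<Rightarrow> bool" where
  "graded_bimodule K A M \<longleftrightarrow>
     graded_module A (left_part M) \<and> graded_module (opp A) (right_part M) \<and>
     (\<forall>i i' j. \<forall>a\<in>gpart A i. \<forall>b\<in>gpart A i'. \<forall>x\<in>el M j.
        gact M i (j + int i') (Inl a) (gact M i' j (Inr b) x)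
          = gact M i' (j + int i) (Inr b) (gact M i j (Inl a) x)) \<and>
     (\<forall>j. \<forall>c\<in>carrier K. \<forall>x\<in>el M j.
        gact M 0 j (Inl (c \<odot>\<^bsub>A\<^esub> \<one>\<^bsub>A\<^esub>)) x = gact M 0 j (Inr (c \<odot>\<^bsub>A\<^esub> \<one>\<^bsub>A\<^esub>)) x)"

definition bi_ops :: "('k, 'a) gralg \<Rightarrow> nat \<Rightarrow> ('a + 'a) set" where
  "bi_ops A i = Inl ` gpart A i \<union> Inr ` gpart A i"

definition shift :: "int \<Rightarrow> ('o, 'm) grmod \<Rightarrow> ('o, 'm) grmod" where
  "shift n M = \<lparr>gcomp = (\<lambda>m. gcomp M (m + n)), gact = (\<lambda>i m. gact M i (m + n))\<rparr>"

definition ghom :: "(nat \<Rightarrow> 'o set) \<Rightarrow> ('o, 'm) grmod \<Rightarrow> ('o, 'n) grmod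
    \<Rightarrow> (int \<Rightarrow> 'm \<Rightarrow> 'n) set" where
  "ghom G M N =
     {f. (\<forall>j. f j \<in> extensional (el M j)
              \<inter> hom (add_monoid (gcomp M j)) (add_monoid (gcomp N j))) \<and>
         (\<forall>i j. \<forall>a\<in>G i. \<forall>x\<in>el M j.
            f (j + int i) (gact M i j a x) = gact N i j a (f j x))}"

definition gsub :: "('o, 'm) grmod \<Rightarrow> (int \<Rightarrow> 'm set) \<Rightarrow> ('o, 'm) grmod" where
  "gsub M N = M\<lparr>gcomp := \<lambda>j. (gcomp M j)\<lparr>carrier := N j\<rparr>\<rparr>"

definition gquot :: "('o, 'm) grmod \<Rightarrow> (int \<Rightarrow> 'm set) \<Rightarrow> ('o, 'm set) grmod" where
  "gquot M N =
     \<lparr>gcomp = (\<lambda>j. mk_grp ((\<lambda>x. N j +>\<^bsub>gcomp M j\<^esub> x) ` el M j) (N j)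
                      (\<lambda>C D. C <+>\<^bsub>gcomp M j\<^esub> D)),
      gact = (\<lambda>i j a C. N (j + int i) <+>\<^bsub>gcomp M (j + int i)\<^esub> (gact M i j a ` C))\<rparr>"

definition graded_submodule :: "(nat \<Rightarrow> 'o set) \<Rightarrow> ('o, 'm) grmod \<Rightarrow> (int \<Rightarrow> 'm set) \<Rightarrow> bool" where
  "graded_submodule G M N \<longleftrightarrow>
     (\<forall>j. additive_subgroup (N j) (gcomp M j)) \<and>
     (\<forall>i j. \<forall>a\<in>G i. \<forall>x\<in>N j. gact M i j a x \<in> N (j + int i))"

definition fin_gen :: "(nat \<Rightarrow> 'o set) \<Rightarrow> ('o, 'm) grmod \<Rightarrow> bool" where
  "fin_gen G M \<longleftrightarrow>
     (\<exists>F. finite F \<and> (\<forall>(j, x)\<in>F. x \<in> el M j) \<and>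
        (\<forall>N. graded_submodule G M N \<and> (\<forall>(j, x)\<in>F. x \<in> N j) \<longrightarrow> (\<forall>j. el M j \<subseteq> N j)))"

text \<open>
  Injectivity is tested against monomorphisms between objects carried by the same type as \<open>I\<close>.
  It is only used for carrier types that are large enough to contain copies of all shifts of the
  ring acting (so that Baer's criterion applies), hence it is injectivity in the full category of
  graded modules.
\<close>

definition injective_obj :: "(nat \<Rightarrow> 'o set) \<Rightarrow> (('o, 'm) grmod \<Rightarrow> bool) \<Rightarrow> ('o, 'm) grmod \<Rightarrow> bool" where
  "injective_obj G Ob I \<longleftrightarrow>
     Ob I \<and>
     (\<forall>M N. \<forall>u\<in>ghom G M N. \<forall>f\<in>ghom G M I.
        Ob M \<and> Ob N \<and> (\<forall>j. inj_on (u j) (el M j)) \<longrightarrow>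
        (\<exists>g\<in>ghom G N I. \<forall>j. \<forall>x\<in>el M j. g j (u j x) = f j x))"

section \<open>Complexes\<close>

text \<open>\<open>cdiff X i j\<close> is the degree \<open>j\<close> component of the differential $X^i \to X^{i+1}$.\<close>

record ('o, 'm) cpx =
  cob :: "int \<Rightarrow> ('o, 'm) grmod"
  cdiff :: "int \<Rightarrow> int \<Rightarrow> 'm \<Rightarrow> 'm"

definition gr_complex :: "(nat \<Rightarrow> 'o set) \<Rightarrow> (('o, 'm) grmod \<Rightarrow> bool) \<Rightarrow> ('o, 'm) cpx \<Rightarrow> bool" where
  "gr_complex G Ob X \<longleftrightarrow>
     (\<forall>i. Ob (cob X i)) \<and>
     (\<forall>i. cdiff X i \<in> ghom G (cob X i) (cob X (i + 1))) \<and>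
     (\<forall>i j. \<forall>x\<in>el (cob X i) j. cdiff X (i + 1) j (cdiff X i j x) = \<zero>\<^bsub>gcomp (cob X (i + 2)) j\<^esub>)"

definition bounded_below :: "('o, 'm) cpx \<Rightarrow> bool" where
  "bounded_below X \<longleftrightarrow> (\<exists>n. \<forall>i<n. \<forall>j. el (cob X i) j = {\<zero>\<^bsub>gcomp (cob X i) j\<^esub>})"

definition bounded_above :: "('o, 'm) cpx \<Rightarrow> bool" where
  "bounded_above X \<longleftrightarrow> (\<exists>n. \<forall>i>n. \<forall>j. el (cob X i) j = {\<zero>\<^bsub>gcomp (cob X i) j\<^esub>})"

definition cocycles :: "('o, 'm) cpx \<Rightarrow> int \<Rightarrow> int \<Rightarrow> 'm set" where
  "cocycles X i j = {x \<in> el (cob X i) j. cdiff X i j x = \<zero>\<^bsub>gcomp (cob X (i + 1)) j\<^esub>}"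

definition coboundaries :: "('o, 'm) cpx \<Rightarrow> int \<Rightarrow> int \<Rightarrow> 'm set" where
  "coboundaries X i j = cdiff X (i - 1) j ` el (cob X (i - 1)) j"

definition cohom :: "('o, 'm) cpx \<Rightarrow> int \<Rightarrow> ('o, 'm set) grmod" where
  "cohom X i = gquot (gsub (cob X i) (cocycles X i)) (coboundaries X i)"

definition acyclic_cpx :: "('o, 'm) cpx \<Rightarrow> bool" where
  "acyclic_cpx X \<longleftrightarrow> (\<forall>i j. el (cohom X i) j = {\<zero>\<^bsub>gcomp (cohom X i) j\<^esub>})"

definition chain_map :: "(nat \<Rightarrow> 'o set) \<Rightarrow> ('o, 'm) cpx \<Rightarrow> ('o, 'n) cpx
    \<Rightarrow> (int \<Rightarrow> int \<Rightarrow> 'm \<Rightarrow> 'n) \<Rightarrow> bool" where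
  "chain_map G X Y f \<longleftrightarrow>
     (\<forall>i. f i \<in> ghom G (cob X i) (cob Y i)) \<and>
     (\<forall>i j. \<forall>x\<in>el (cob X i) j. f (i + 1) j (cdiff X i j x) = cdiff Y i j (f i j x))"

definition cohom_map :: "('o, 'n) cpx \<Rightarrow> (int \<Rightarrow> int \<Rightarrow> 'm \<Rightarrow> 'n)
    \<Rightarrow> int \<Rightarrow> int \<Rightarrow> 'm set \<Rightarrow> 'n set" where
  "cohom_map Y f i j C = coboundaries Y i j <+>\<^bsub>gcomp (cob Y i) j\<^esub> (f i j ` C)"

definition quasi_iso :: "(nat \<Rightarrow> 'o set) \<Rightarrow> ('o, 'm) cpx \<Rightarrow> ('o, 'n) cpx
    \<Rightarrow> (int \<Rightarrow> int \<Rightarrow> 'm \<Rightarrow> 'n) \<Rightarrow> bool" where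
  "quasi_iso G X Y f \<longleftrightarrow>
     chain_map G X Y f \<and>
     (\<forall>i j. bij_betw (cohom_map Y f i j) (el (cohom X i) j) (el (cohom Y i) j))"

definition stalk :: "('o, 'm) grmod \<Rightarrow> ('o, 'm) cpx" where
  "stalk M =
     (let N = (\<lambda>i::int. if i = 0 then M else gsub M (\<lambda>j. {\<zero>\<^bsub>gcomp M j\<^esub>}))
      in \<lparr>cob = N, cdiff = (\<lambda>i j. \<lambda>x\<in>el (N i) j. \<zero>\<^bsub>gcomp M j\<^esub>)\<rparr>)"

definition left_cpx :: "('a + 'a, 'm) cpx \<Rightarrow> ('a, 'm) cpx" where
  "left_cpx X = \<lparr>cob = (\<lambda>i. left_part (cob X i)), cdiff = cdiff X\<rparr>"

definition right_cpx :: "('a + 'a, 'm) cpx \<Rightarrow> ('a, 'm) cpx" where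
  "right_cpx X = \<lparr>cob = (\<lambda>i. right_part (cob X i)), cdiff = cdiff X\<rparr>"

text \<open>
  Injective resolutions of a complex carried by \<open>'x\<close> are sought on the type
  \<open>'a \<times> nat \<Rightarrow> 'x\<close>. If \<open>'x\<close> has at least two elements (otherwise the complex is zero), the
  cardinality $\kappa$ of this type satisfies $\kappa^{|\mathtt{'a}|} = \kappa^{\aleph_0} = \kappa$
  and bounds the cardinality of the algebra (and of its enveloping algebra) and of the complex.
  As a graded module \<open>M\<close> embeds into a cofree one, whose components are products of
  $\mathrm{Hom}_k(A_i, M_{j+i})$ (and likewise for bimodules), bounded below injective
  resolutions of bounded below complexes exist on this type.
\<close>

type_synonym ('a, 'x) res = "'a \<times> nat \<Rightarrow> 'x"

definition inj_resolution :: "(nat \<Rightarrow> 'o set) \<Rightarrow> (('o, 'n) grmod \<Rightarrow> bool)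
    \<Rightarrow> ('o, 'm) cpx \<Rightarrow> ('o, 'n) cpx \<Rightarrow> (int \<Rightarrow> int \<Rightarrow> 'm \<Rightarrow> 'n) \<Rightarrow> bool" where
  "inj_resolution G Ob X I \<eta> \<longleftrightarrow>
     gr_complex G Ob I \<and> bounded_below I \<and> (\<forall>i. injective_obj G Ob (cob I i)) \<and>
     quasi_iso G X I \<eta>"

text \<open>
  Isomorphism in the derived category, as a pair of quasi-isomorphisms \<open>X \<rightarrow> Z \<leftarrow> Y\<close>.
  This is used with \<open>X\<close> bounded below on a type \<open>('a, 'x) res\<close> that is also large enough for an
  injective resolution of \<open>Y\<close>, so that nothing is lost by taking \<open>Z\<close> on the type of \<open>X\<close>.
\<close>

definition derived_iso :: "(nat \<Rightarrow> 'o set) \<Rightarrow> (('o, 'm) grmod \<Rightarrow> bool)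
    \<Rightarrow> ('o, 'm) cpx \<Rightarrow> ('o, 'n) cpx \<Rightarrow> bool" where
  "derived_iso G Ob X Y \<longleftrightarrow>
     (\<exists>Z f g. gr_complex G Ob Z \<and> quasi_iso G X Z f \<and> quasi_iso G Y Z g)"

section \<open>Torsion and Hom complexes\<close>

definition torsion :: "(nat \<Rightarrow> 'o set) \<Rightarrow> ('o, 'm) grmod \<Rightarrow> int \<Rightarrow> 'm set" where
  "torsion T M j =
     {x \<in> el M j. \<exists>n. \<forall>i\<ge>n. \<forall>a\<in>T i. gact M i j a x = \<zero>\<^bsub>gcomp M (j + int i)\<^esub>}"

definition torsion_cpx :: "(nat \<Rightarrow> 'o set) \<Rightarrow> ('o, 'm) cpx \<Rightarrow> ('o, 'm) cpx" where
  "torsion_cpx T X =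
     \<lparr>cob = (\<lambda>i. gsub (cob X i) (torsion T (cob X i))),
      cdiff = (\<lambda>i j. restrict (cdiff X i j) (torsion T (cob X i) j))\<rparr>"

text \<open>
  The component of $\underline{\mathrm{Hom}}(X,Y)^n$ of degree \<open>j\<close> is
  $\prod_p \mathrm{Hom}(X^p, Y^{p+n}(j))$, with differential
  $f \mapsto d f - (-1)^n f d$. The argument \<open>act\<close> supplies the action on $\mathrm{Hom}^n$.
\<close>

definition hom_cpx :: "(nat \<Rightarrow> 'o set)
    \<Rightarrow> (int \<Rightarrow> nat \<Rightarrow> int \<Rightarrow> 'c \<Rightarrow> (int \<Rightarrow> int \<Rightarrow> 'x \<Rightarrow> 'y) \<Rightarrow> (int \<Rightarrow> int \<Rightarrow> 'x \<Rightarrow> 'y))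
    \<Rightarrow> ('o, 'x) cpx \<Rightarrow> ('o, 'y) cpx \<Rightarrow> ('c, int \<Rightarrow> int \<Rightarrow> 'x \<Rightarrow> 'y) cpx" where
  "hom_cpx T act X Y =
     \<lparr>cob = (\<lambda>n.
        \<lparr>gcomp = (\<lambda>j. mk_grp
            {f. \<forall>p. f p \<in> ghom T (cob X p) (shift j (cob Y (p + n)))}
            (\<lambda>p m. \<lambda>x\<in>el (cob X p) m. \<zero>\<^bsub>gcomp (cob Y (p + n)) (m + j)\<^esub>)
            (\<lambda>f g p m. \<lambda>x\<in>el (cob X p) m. f p m x \<oplus>\<^bsub>gcomp (cob Y (p + n)) (m + j)\<^esub> g p m x)),
         gact = act n\<rparr>),
      cdiff = (\<lambda>n j f p m. \<lambda>x\<in>el (cob X p) m.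
        let u = cdiff Y (p + n) (m + j) (f p m x);
            v = f (p + 1) m (cdiff X p m x);
            H = gcomp (cob Y (p + n + 1)) (m + j)
        in if even n then u \<ominus>\<^bsub>H\<^esub> v else u \<oplus>\<^bsub>H\<^esub> v)\<rparr>"

text \<open>Without operators: only the underlying complex of graded abelian groups.\<close>

definition plain_hom_cpx :: "(nat \<Rightarrow> 'o set) \<Rightarrow> ('o, 'x) cpx \<Rightarrow> ('o, 'y) cpx
    \<Rightarrow> (unit, int \<Rightarrow> int \<Rightarrow> 'x \<Rightarrow> 'y) cpx" where
  "plain_hom_cpx T X Y = hom_cpx T (\<lambda>_ _ _ _ f. f) X Y"

primrec other_side :: "'a + 'a \<Rightarrow> 'a + 'a" where
  "other_side (Inl a) = Inr a"
| "other_side (Inr a) = Inl a"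

text \<open>
  For complexes of bimodules and \<open>s = Inl\<close> the maps are left linear and
  $(a f)(x) = f(x a)$, $(f b)(x) = f(x) b$; for \<open>s = Inr\<close> they are right linear and
  $(a f)(x) = a f(x)$, $(f b)(x) = f(b x)$.
\<close>

definition bi_hom_cpx :: "('k, 'a) gralg \<Rightarrow> ('a \<Rightarrow> 'a + 'a) \<Rightarrow> ('a + 'a, 'x) cpx
    \<Rightarrow> ('a + 'a, 'y) cpx \<Rightarrow> ('a + 'a, int \<Rightarrow> int \<Rightarrow> 'x \<Rightarrow> 'y) cpx" where
  "bi_hom_cpx A s X Y =
     hom_cpx (\<lambda>i. s ` gpart A i)
       (\<lambda>n i j c f p m. \<lambda>x\<in>el (cob X p) m.
          if c \<in> range s then f p (m + int i) (gact (cob X p) i m (other_side c) x)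
          else gact (cob Y (p + n)) i (m + j) c (f p m x))
       X Y"

section \<open>The bimodules $A$ and $\mathrm{D}(A)$ and the module $S$\<close>

definition zpart :: "('k, 'a) gralg \<Rightarrow> int \<Rightarrow> 'a set" where
  "zpart A j = (if 0 \<le> j then gpart A (nat j) else {\<zero>\<^bsub>A\<^esub>})"

definition alg_bimod :: "('k, 'a) gralg \<Rightarrow> ('a + 'a, 'a) grmod" where
  "alg_bimod A =
     \<lparr>gcomp = (\<lambda>j. mk_grp (zpart A j) \<zero>\<^bsub>A\<^esub> (\<lambda>x y. x \<oplus>\<^bsub>A\<^esub> y)),
      gact = (\<lambda>i j c x. case c of Inl a \<Rightarrow> a \<otimes>\<^bsub>A\<^esub> x | Inr b \<Rightarrow> x \<otimes>\<^bsub>A\<^esub> b)\<rparr>"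

text \<open>$\mathrm{D}(A)_j = \mathrm{Hom}_k(A_{-j}, k)$ with $(a \phi)(x) = \phi(x a)$ and
  $(\phi b)(x) = \phi(b x)$.\<close>

definition dual_bimod :: "'k ring \<Rightarrow> ('k, 'a) gralg \<Rightarrow> ('a + 'a, 'a \<Rightarrow> 'k) grmod" where
  "dual_bimod K A =
     \<lparr>gcomp = (\<lambda>j. mk_grp
         {\<phi> \<in> zpart A (- j) \<rightarrow>\<^sub>E carrier K.
            (\<forall>x\<in>zpart A (- j). \<forall>y\<in>zpart A (- j). \<phi> (x \<oplus>\<^bsub>A\<^esub> y) = \<phi> x \<oplus>\<^bsub>K\<^esub> \<phi> y) \<and>
            (\<forall>c\<in>carrier K. \<forall>x\<in>zpart A (- j). \<phi> (c \<odot>\<^bsub>A\<^esub> x) = c \<otimes>\<^bsub>K\<^esub> \<phi> x)}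
         (\<lambda>x\<in>zpart A (- j). \<zero>\<^bsub>K\<^esub>)
         (\<lambda>\<phi> \<psi>. \<lambda>x\<in>zpart A (- j). \<phi> x \<oplus>\<^bsub>K\<^esub> \<psi> x)),
      gact = (\<lambda>i j c \<phi>. \<lambda>x\<in>zpart A (- (j + int i)).
         case c of Inl a \<Rightarrow> \<phi> (x \<otimes>\<^bsub>A\<^esub> a) | Inr b \<Rightarrow> \<phi> (b \<otimes>\<^bsub>A\<^esub> x))\<rparr>"

definition S_mod :: "('k, 'a) gralg \<Rightarrow> ('a, 'a set) grmod" where
  "S_mod A = gquot (left_part (alg_bimod A)) (\<lambda>j. graded_Jacobson A \<inter> zpart A j)"

section \<open>Balanced dualizing complexes\<close>

definition finite_inj_dim :: "('k, 'a) gralg \<Rightarrow> ('a, 'x) cpx \<Rightarrow> bool" where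
  "finite_inj_dim A X \<longleftrightarrow>
     (\<exists>(E :: ('a, ('a, 'x) res) cpx) \<eta>.
        inj_resolution (gpart A) (graded_module A) X E \<eta> \<and> bounded_above E)"

text \<open>
  For an injective resolution \<open>\<eta>\<close> of \<open>R\<close> by bimodules on \<open>I\<close>, the natural morphism from \<open>A\<close> to
  \<open>bi_hom_cpx A s R I\<close>: the image of \<open>a\<close> is \<open>\<eta>\<close> composed with right (\<open>s = Inl\<close>) or left
  (\<open>s = Inr\<close>) multiplication by \<open>a\<close>.
\<close>

definition nat_map :: "('k, 'a) gralg \<Rightarrow> ('a \<Rightarrow> 'a + 'a) \<Rightarrow> ('a + 'a, 'r) cpx \<Rightarrow> ('a + 'a, 'i) cpx
    \<Rightarrow> (int \<Rightarrow> int \<Rightarrow> 'r \<Rightarrow> 'i) \<Rightarrow> int \<Rightarrow> int \<Rightarrow> 'a \<Rightarrow> (int \<Rightarrow> int \<Rightarrow> 'r \<Rightarrow> 'i)" where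
  "nat_map A s R I \<eta> n j =
     (\<lambda>a\<in>el (cob (stalk (alg_bimod A)) n) j.
        if n = 0 \<and> 0 \<le> j
        then (\<lambda>p m. \<lambda>x\<in>el (cob R p) m.
                \<eta> p (m + j) (gact (cob R p) (nat j) m (other_side (s a)) x))
        else \<zero>\<^bsub>gcomp (cob (bi_hom_cpx A s R I) n) j\<^esub>)"

text \<open>
  Injective graded $A^e$-modules are injective over \<open>A\<close> and over \<open>A\<^sup>o\<close>, so all the derived functors
  can be computed by one resolution by injective bimodules. A morphism in the derived category
  represented by a chain map is an isomorphism iff the chain map is a quasi-isomorphism.
\<close>

definition balanced_dualizing_complex :: "'k ring \<Rightarrow> ('k, 'a) gralg \<Rightarrow> ('a + 'a, 'r) cpx \<Rightarrow> bool" where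
  "balanced_dualizing_complex K A R \<longleftrightarrow>
     gr_complex (bi_ops A) (graded_bimodule K A) R \<and> bounded_below R \<and> bounded_above R \<and>
     finite_inj_dim A (left_cpx R) \<and> finite_inj_dim (opp A) (right_cpx R) \<and>
     (\<forall>i. fin_gen (gpart A) (cohom (left_cpx R) i)) \<and>
     (\<forall>i. fin_gen (gpart A) (cohom (right_cpx R) i)) \<and>
     (\<exists>(I :: ('a + 'a, ('a, 'r) res) cpx) \<eta>.
        inj_resolution (bi_ops A) (graded_bimodule K A) R I \<eta> \<and>
        quasi_iso (bi_ops A) (stalk (alg_bimod A)) (bi_hom_cpx A Inl R I) (nat_map A Inl R I \<eta>) \<and>
        quasi_iso (bi_ops A) (stalk (alg_bimod A)) (bi_hom_cpx A Inr R I) (nat_map A Inr R I \<eta>) \<and>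
        derived_iso (bi_ops A) (graded_bimodule K A)
          (torsion_cpx (\<lambda>i. Inl ` gpart A i) I) (stalk (dual_bimod K A)) \<and>
        derived_iso (bi_ops A) (graded_bimodule K A)
          (torsion_cpx (\<lambda>i. Inr ` gpart A i) I) (stalk (dual_bimod K A)))"

section \<open>Castelnuovo-Mumford and Ext regularity\<close>

definition Dplus_fg :: "('k, 'a) gralg \<Rightarrow> ('a, 'x) cpx \<Rightarrow> bool" where
  "Dplus_fg A X \<longleftrightarrow>
     gr_complex (gpart A) (graded_module A) X \<and> bounded_below X \<and>
     (\<forall>i. fin_gen (gpart A) (cohom X i))"

definition sup_deg :: "('o, 'm) cpx \<Rightarrow> ereal" where
  "sup_deg X =
     Sup {ereal (real_of_int (i + j)) |i j. el (cohom X i) j \<noteq> {\<zero>\<^bsub>gcomp (cohom X i) j\<^esub>}}"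

text \<open>
  The complexes representing $R\Gamma_A(X)$ and $R\underline{\mathrm{Hom}}_A(Y,X)$, one for each
  injective resolution of \<open>X\<close>. They are all quasi-isomorphic, so the suprema in the definitions
  of the regularities are taken over families with a single value.
\<close>

definition RGamma :: "('k, 'a) gralg \<Rightarrow> ('a, 'x) cpx \<Rightarrow> ('a, ('a, 'x) res) cpx set" where
  "RGamma A X =
     {torsion_cpx (gpart A) I |I \<eta>. inj_resolution (gpart A) (graded_module A) X I \<eta>}"

definition RHom :: "('k, 'a) gralg \<Rightarrow> ('a, 'y) cpx \<Rightarrow> ('a, 'x) cpx
    \<Rightarrow> (unit, int \<Rightarrow> int \<Rightarrow> 'y \<Rightarrow> ('a, 'x) res) cpx set" where
  "RHom A Y X =
     {plain_hom_cpx (gpart A) Y I |I \<eta>. inj_resolution (gpart A) (graded_module A) X I \<eta>}"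

definition CMreg :: "('k, 'a) gralg \<Rightarrow> ('a, 'x) cpx \<Rightarrow> ereal" where
  "CMreg A X = (SUP Y\<in>RGamma A X. sup_deg Y)"

definition Ex_reg :: "('k, 'a) gralg \<Rightarrow> ('a, 'x) cpx \<Rightarrow> ereal" where
  "Ex_reg A X = (SUP Y\<in>RHom A (stalk (S_mod A)) X. sup_deg Y)"

end

theory Submission
  imports Defs
begin

text \<open>
  Fix an injective resolution \<open>I\<close> of \<open>X\<close>. Semisimplicity of \<open>A\<^sub>0\<close> gives that \<open>J\<close> is the part of \<open>A\<close> of
  positive degree, so $\underline{\mathrm{Hom}}_A(S, I)$ is the subcomplex of socles of \<open>I\<close>. It has to
  be shown that, for every \<open>q\<close>, the torsion subcomplex of \<open>I\<close> is exact in total degrees \<open>\<ge> q\<close> iff the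
  socle subcomplex is. One direction is the filtration of a torsion module by $A_{\geq s}$: multiples
  of top degree lie in the socle. The other one replaces minimal free resolutions of cyclic modules:
  a torsion cocycle \<open>y\<close> of total degree \<open>\<ge> q\<close> is \<open>d z\<close> for a torsion \<open>z\<close> with the same annihilator.
  In both cases a given preimage is corrected one homogeneous generator of a left ideal at a time, using
  Baer's criterion in the form of extensions of maps from \<open>ann z + A k\<close> to \<open>A\<close>.
\<close>

section \<open>Graded algebras\<close>

text \<open>Comparing all \<open>q\<close> suffices because sup.deg < q says exactly that cohomology
  vanishes in total degrees >= q. The obstacle is the bookkeeping of total degrees. If d z = y and k
  of degree e kills y, then k z is a cocycle one step lower in the complex and e steps higher in
  internal degree, so its total degree is that of y plus e - 1. A relation of degree 0 would leave
  the range where exactness is known. Semisimplicity removes it: the degree 0 part of ann y has an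
  idempotent right identity e, and z - e z is killed by that part. Annihilators are tracked because
  ann y contained in ann z means that y -> z is a well-defined linear map on A y. This makes the
  next extension problem solvable, and it sends socle elements to socle elements. Noetherianity
  makes the number of corrections finite, and boundedness below starts the induction.\<close>

locale gr_alg =
  fixes K :: "'k ring" and A :: "('k, 'a) gralg" (structure)
  assumes graded: "graded_algebra K A"

sublocale gr_alg \<subseteq> ring A
  using graded by (simp add: graded_algebra_def)

context gr_alg
begin

lemma gpart_subgroup: "additive_subgroup (gpart A i) A"
proof -
  have "submodule (gpart A i) K A"
    using graded by (simp add: graded_algebra_def)
  then show ?thesis
    by (simp add: submodule_def additive_subgroup_def)
qed

lemma gpart_carrier: "x \<in> gpart A i \<Longrightarrow> x \<in> carrier A"
  using additive_subgroup.a_subset[OF gpart_subgroup] by auto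

lemma gpart_zero [simp]: "\<zero> \<in> gpart A i"
  by (rule additive_subgroup.zero_closed[OF gpart_subgroup])

lemma gpart_add [simp]: "x \<in> gpart A i \<Longrightarrow> y \<in> gpart A i \<Longrightarrow> x \<oplus> y \<in> gpart A i"
  by (rule additive_subgroup.a_closed[OF gpart_subgroup])

lemma gpart_minus [simp]: "x \<in> gpart A i \<Longrightarrow> \<ominus> x \<in> gpart A i"
  by (rule additive_subgroup.a_inv_closed[OF gpart_subgroup])

lemma gpart_one [simp]: "\<one> \<in> gpart A 0"
  using graded by (simp add: graded_algebra_def)

lemma gpart_mult [simp]: "x \<in> gpart A i \<Longrightarrow> y \<in> gpart A j \<Longrightarrow> x \<otimes> y \<in> gpart A (i + j)"
  using graded by (simp add: graded_algebra_def)

lemma gpart_mult_zero: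
  "x \<in> gpart A 0 \<Longrightarrow> y \<in> gpart A j \<Longrightarrow> x \<otimes> y \<in> gpart A j"
  "x \<in> gpart A j \<Longrightarrow> y \<in> gpart A 0 \<Longrightarrow> x \<otimes> y \<in> gpart A j"
  using gpart_mult[of x 0 y j] gpart_mult[of x j y 0] by simp_all

section \<open>Decompositions into homogeneous components\<close>

lemma is_decomp_exists: "x \<in> carrier A \<Longrightarrow> \<exists>f. is_decomp A x f"
  using graded by (auto simp: graded_algebra_def)

lemma is_decomp_unique: "x \<in> carrier A \<Longrightarrow> is_decomp A x f \<Longrightarrow> is_decomp A x g \<Longrightarrow> f = g"
  using graded by (auto simp: graded_algebra_def)

lemma is_decomp_part: "is_decomp A x f \<Longrightarrow> f i \<in> gpart A i"
  by (simp add: is_decomp_def)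

lemma is_decomp_carrier: "is_decomp A x f \<Longrightarrow> x \<in> carrier A"
  using gpart_carrier by (auto simp: is_decomp_def intro!: finsum_closed)

lemma is_decompI:
  assumes "\<And>i. f i \<in> gpart A i" "finite I" "{i. f i \<noteq> \<zero>} \<subseteq> I" "x = finsum A f I"
  shows "is_decomp A x f"
proof -
  have "finsum A f {i. f i \<noteq> \<zero>} = finsum A f I"
    using assms gpart_carrier by (intro add.finprod_mono_neutral_cong_left) auto
  then show ?thesis
    using assms by (auto simp: is_decomp_def intro: finite_subset)
qed

lemma is_decomp_homog:
  assumes "x \<in> gpart A i"
  shows "is_decomp A x (\<lambda>m. if m = i then x else \<zero>)"
  using assms gpart_carrier[OF assms]
  by (intro is_decompI[where I = "{i}"]) auto

lemma is_decomp_zero: "is_decomp A \<zero> (\<lambda>m. \<zero>)"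
  by (rule is_decompI[where I = "{}"]) auto

lemma is_decomp_add:
  assumes "is_decomp A x f" "is_decomp A y g"
  shows "is_decomp A (x \<oplus> y) (\<lambda>i. f i \<oplus> g i)"
proof (rule is_decompI)
  let ?I = "{i. f i \<noteq> \<zero>} \<union> {i. g i \<noteq> \<zero>}"
  show "finite ?I" using assms by (auto simp: is_decomp_def)
  show "{i. f i \<oplus> g i \<noteq> \<zero>} \<subseteq> ?I" by auto
  have fc: "f \<in> B \<rightarrow> carrier A" and gc: "g \<in> B \<rightarrow> carrier A" for B
    using assms is_decomp_part gpart_carrier by blast+
  have "x = finsum A f ?I"
    using assms(1) fc \<open>finite ?I\<close> unfolding is_decomp_def
    by (auto intro!: add.finprod_mono_neutral_cong_left)
  moreover have "y = finsum A g ?I"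
    using assms(2) gc \<open>finite ?I\<close> unfolding is_decomp_def
    by (auto intro!: add.finprod_mono_neutral_cong_left)
  ultimately show "x \<oplus> y = (\<Oplus>i\<in>?I. f i \<oplus> g i)"
    using fc gc by (simp add: finsum_addf)
qed (use assms is_decomp_part in auto)

section \<open>Graded left ideals given by their homogeneous parts\<close>

definition graded_family :: "(nat \<Rightarrow> 'a set) \<Rightarrow> bool" where
  "graded_family L \<longleftrightarrow>
     (\<forall>i. L i \<subseteq> gpart A i \<and> \<zero> \<in> L i \<and> (\<forall>x\<in>L i. \<forall>y\<in>L i. x \<oplus> y \<in> L i)) \<and>
     (\<forall>i j. \<forall>a\<in>gpart A i. \<forall>x\<in>L j. a \<otimes> x \<in> L (i + j))"

text \<open>The passage from a family of homogeneous parts to an ordinary left ideal, which is what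
  \<open>left_noetherian\<close> and \<open>maximal_graded_left_ideal\<close> speak of. Negatives
  are absent from \<open>graded_family\<close> because they are multiples by
  \<open>\<ominus> \<one>\<close>, of degree 0.\<close>

definition family_sum :: "(nat \<Rightarrow> 'a set) \<Rightarrow> 'a set" where
  "family_sum L = {x. \<exists>f. is_decomp A x f \<and> (\<forall>i. f i \<in> L i)}"

lemma left_idealI:
  assumes "L \<subseteq> carrier A" "\<zero> \<in> L" "\<And>x y. x \<in> L \<Longrightarrow> y \<in> L \<Longrightarrow> x \<oplus> y \<in> L"
    and "\<And>a x. a \<in> carrier A \<Longrightarrow> x \<in> L \<Longrightarrow> a \<otimes> x \<in> L"
  shows "left_ideal A L"
proof -
  have "\<ominus> x \<in> L" if "x \<in> L" for x
  proof -
    have "\<ominus> x = (\<ominus> \<one>) \<otimes> x" using that assms(1) by (simp add: l_minus subset_iff)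
    then show ?thesis using assms(4)[OF _ that, of "\<ominus> \<one>"] by simp
  qed
  then show ?thesis
    unfolding left_ideal_def additive_subgroup_def using assms
    by (auto intro!: add.subgroupI)
qed

lemma family_sum_homog:
  assumes "graded_family L" "x \<in> gpart A i"
  shows "x \<in> family_sum L \<longleftrightarrow> x \<in> L i"
proof
  assume "x \<in> family_sum L"
  then obtain f where f: "is_decomp A x f" "\<And>i. f i \<in> L i"
    by (auto simp: family_sum_def)
  have "f = (\<lambda>m. if m = i then x else \<zero>)"
    by (rule is_decomp_unique[OF gpart_carrier[OF assms(2)] f(1) is_decomp_homog[OF assms(2)]])
  then show "x \<in> L i" using f(2)[of i] by simp
next
  assume "x \<in> L i"
  then show "x \<in> family_sum L"
    using is_decomp_homog[OF assms(2)] assms(1)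
    by (auto simp: family_sum_def graded_family_def intro!: exI[of _ "\<lambda>m. if m = i then x else \<zero>"])
qed

lemma graded_left_ideal_family_sum:
  assumes L: "graded_family L"
  shows "graded_left_ideal A (family_sum L)"
proof -
  let ?S = "family_sum L"
  have Lg: "L i \<subseteq> gpart A i" for i using L by (simp add: graded_family_def)
  have sub: "?S \<subseteq> carrier A" using is_decomp_carrier by (auto simp: family_sum_def)
  have zero: "\<zero> \<in> ?S"
    using is_decomp_zero L unfolding family_sum_def graded_family_def by blast
  have add: "x \<oplus> y \<in> ?S" if "x \<in> ?S" "y \<in> ?S" for x y
  proof -
    from that obtain f g where "is_decomp A x f" "\<forall>i. f i \<in> L i" "is_decomp A y g" "\<forall>i. g i \<in> L i"
      by (auto simp: family_sum_def)
    then show ?thesis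
      using is_decomp_add[of x f y g] L unfolding family_sum_def graded_family_def by blast
  qed
  have sum: "finsum A f F \<in> ?S" if "finite F" "\<And>i. i \<in> F \<Longrightarrow> f i \<in> ?S" for f :: "nat \<Rightarrow> 'a" and F
    using that
  proof (induction F rule: finite_induct)
    case (insert i F)
    then have "f \<in> F \<rightarrow> carrier A" "f i \<in> carrier A" using sub by auto
    then show ?case using insert add by (simp add: finsum_insert)
  qed (simp add: zero)
  have mult: "a \<otimes> x \<in> ?S" if a: "a \<in> carrier A" and x: "x \<in> ?S" for a x
  proof -
    obtain f where f: "is_decomp A x f" "\<And>i. f i \<in> L i" using x by (auto simp: family_sum_def)
    obtain g where g: "is_decomp A a g" using is_decomp_exists[OF a] ..
    define F G where "F = {i. f i \<noteq> \<zero>}" and "G = {i. g i \<noteq> \<zero>}"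
    have fin: "finite F" "finite G" and eq: "x = finsum A f F" "a = finsum A g G"
      using f(1) g by (auto simp: is_decomp_def F_def G_def)
    have c: "\<And>i. f i \<in> carrier A" "\<And>i. g i \<in> carrier A"
      using is_decomp_part gpart_carrier f(1) g by blast+
    have xc: "x \<in> carrier A" using f(1) by (rule is_decomp_carrier)
    have 1: "g j \<otimes> f i \<in> ?S" for i j
    proof -
      have "g j \<otimes> f i \<in> L (j + i)"
        using L f(2) is_decomp_part[OF g] by (auto simp: graded_family_def)
      then show ?thesis using family_sum_homog[OF L, of "g j \<otimes> f i" "j + i"] Lg by auto
    qed
    have 2: "g j \<otimes> x \<in> ?S" for j
    proof -
      have "g j \<otimes> x = finsum A (\<lambda>i. g j \<otimes> f i) F"
        unfolding eq(1) using fin c by (intro finsum_rdistr) auto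
      also have "\<dots> \<in> ?S" using sum[OF fin(1) 1] .
      finally show ?thesis .
    qed
    have "a \<otimes> x = finsum A (\<lambda>j. g j \<otimes> x) G"
      unfolding eq(2) using fin c xc by (intro finsum_ldistr) auto
    also have "\<dots> \<in> ?S" using sum[OF fin(2) 2] .
    finally show ?thesis .
  qed
  have "f i \<in> ?S" if x: "x \<in> ?S" and f: "is_decomp A x f" for x f i
  proof -
    from x obtain g where g: "is_decomp A x g" "\<And>i. g i \<in> L i" by (auto simp: family_sum_def)
    then have "f = g" using is_decomp_unique f is_decomp_carrier by blast
    then show ?thesis using g(2)[of i] family_sum_homog[OF L, of "f i" i] is_decomp_part[OF f] by blast
  qed
  then show ?thesis
    unfolding graded_left_ideal_def using left_idealI[OF sub zero add mult] by blast
qed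

text \<open>Noetherianity is applied to \<open>family_sum L\<close>, and the generators obtained are
  split into their homogeneous components: a graded family containing these components has a sum
  containing the generators. Generation is phrased as minimality among graded families because
  \<open>L'\<close> will be the annihilator of a corrected element.\<close>

lemma graded_family_generators:
  assumes noeth: "left_noetherian A" and L: "graded_family L"
  obtains H where "finite H" "\<And>i k. (i, k) \<in> H \<Longrightarrow> k \<in> L i"
    "\<And>L' i. graded_family L' \<Longrightarrow> (\<And>i k. (i, k) \<in> H \<Longrightarrow> k \<in> L' i) \<Longrightarrow> L i \<subseteq> L' i"
proof -
  have lid: "left_ideal A (family_sum L')" if "graded_family L'" for L'
    using graded_left_ideal_family_sum[OF that] by (simp add: graded_left_ideal_def)
  obtain B where B: "finite B" "B \<subseteq> family_sum L"
    "\<And>L'. left_ideal A L' \<Longrightarrow> B \<subseteq> L' \<Longrightarrow> family_sum L \<subseteq> L'"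
  proof -
    have "\<exists>B. finite B \<and> B \<subseteq> family_sum L \<and>
        (\<forall>L'. left_ideal A L' \<and> B \<subseteq> L' \<longrightarrow> family_sum L \<subseteq> L')"
      using noeth lid[OF L] unfolding left_noetherian_def by simp
    then show thesis using that by auto
  qed
  obtain c where c: "\<And>b. b \<in> B \<Longrightarrow> is_decomp A b (c b)" "\<And>b i. b \<in> B \<Longrightarrow> c b i \<in> L i"
    using B(2) unfolding family_sum_def subset_iff mem_Collect_eq by metis
  define H where "H = (\<Union>b\<in>B. (\<lambda>i. (i, c b i)) ` {i. c b i \<noteq> \<zero>})"
  show thesis
  proof (rule that[of H])
    show "finite H" unfolding H_def using B(1) c(1) by (auto simp: is_decomp_def)
    show "k \<in> L i" if "(i, k) \<in> H" for i k using that c(2) by (auto simp: H_def)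
  next
    fix L' i
    assume L': "graded_family L'" and H: "\<And>i k. (i, k) \<in> H \<Longrightarrow> k \<in> L' i"
    have "c b i \<in> L' i" if "b \<in> B" for b i
    proof (cases "c b i = \<zero>")
      case True
      then show ?thesis using L' by (simp add: graded_family_def)
    next
      case False
      then show ?thesis using that H[of i "c b i"] by (auto simp: H_def)
    qed
    then have "B \<subseteq> family_sum L'" using c(1) by (auto simp: family_sum_def)
    then have "family_sum L \<subseteq> family_sum L'" using B(3) lid[OF L'] by blast
    moreover have "L i \<subseteq> gpart A i" using L by (simp add: graded_family_def)
    ultimately show "L i \<subseteq> L' i"
      using family_sum_homog[OF L] family_sum_homog[OF L'] by blast
  qed
qed

text \<open>Split 1 = e + e' along \<open>L\<close> and a complementary left ideal of A_0. For x in
  \<open>L\<close> the element x e' = x - x e lies in both summands, hence is zero.\<close>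

lemma semisimple_idempotent:
  assumes ss: "semisimple_ring (A\<lparr>carrier := gpart A 0\<rparr>)"
    and L: "L \<subseteq> gpart A 0" "\<zero> \<in> L" "\<And>x y. x \<in> L \<Longrightarrow> y \<in> L \<Longrightarrow> x \<oplus> y \<in> L"
      "\<And>a x. a \<in> gpart A 0 \<Longrightarrow> x \<in> L \<Longrightarrow> a \<otimes> x \<in> L"
  obtains e where "e \<in> L" "\<And>x. x \<in> L \<Longrightarrow> x \<otimes> e = x"
proof -
  let ?A0 = "A\<lparr>carrier := gpart A 0\<rparr>"
  have grp: "group (add_monoid ?A0)"
    using add.subgroup_imp_group[OF additive_subgroup.a_subgroup[OF gpart_subgroup]] by simp
  \<comment> \<open>The subgroup condition over the restricted record uses the inverse computed
    there, which has to be identified with the one of \<open>A\<close>.\<close>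
  have inv: "inv\<^bsub>add_monoid ?A0\<^esub> x = \<ominus> x" if "x \<in> gpart A 0" for x
    using group.inv_equality[OF grp, of "\<ominus> x" x] that gpart_carrier[OF that] by (simp add: l_neg)
  have minus: "\<ominus> x \<in> L" if "x \<in> L" for x
  proof -
    have "\<ominus> x = (\<ominus> \<one>) \<otimes> x" using gpart_carrier[OF subsetD[OF L(1) that]] by (simp add: l_minus)
    then show ?thesis using L(4)[OF _ that, of "\<ominus> \<one>"] by simp
  qed
  have "left_ideal ?A0 L"
    unfolding left_ideal_def additive_subgroup_def
  proof (intro conjI)
    show "subgroup L (add_monoid ?A0)"
    proof (rule group.subgroupI[OF grp])
      show "inv\<^bsub>add_monoid ?A0\<^esub> x \<in> L" if "x \<in> L" for x
        using inv[of x] minus[OF that] L(1) that by auto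
    qed (use L in auto)
  qed (use L(4) in simp)
  then obtain L' where L': "left_ideal ?A0 L'" "L \<inter> L' = {\<zero>}" "L <+>\<^bsub>?A0\<^esub> L' = gpart A 0"
    using ss by (auto simp: semisimple_ring_def)
  then have "\<one> \<in> L <+>\<^bsub>?A0\<^esub> L'" by simp
  then obtain e e' where e: "e \<in> L" "e' \<in> L'" "\<one> = e \<oplus> e'"
    by (auto simp: set_add_def set_mult_def)
  have L'0: "L' \<subseteq> gpart A 0"
    using L'(1) additive_subgroup.a_subset by (fastforce simp: left_ideal_def)
  show thesis
  proof (rule that[OF e(1)])
    fix x assume x: "x \<in> L"
    have xe': "x \<otimes> e' \<in> L'" using L'(1) e(2) x L(1) by (auto simp: left_ideal_def)
    have c: "x \<in> carrier A" "e \<in> carrier A" "e' \<in> carrier A"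
      using x e L(1) L'0 gpart_carrier by blast+
    have eq: "x = x \<otimes> e \<oplus> x \<otimes> e'"
      using c r_distr[of e e' x] r_one[of x] unfolding e(3) by simp
    have "x \<otimes> e' = \<ominus> (x \<otimes> e) \<oplus> x"
      using add.inv_solve_left[of "x \<otimes> e'" "x \<otimes> e" x] c eq by (metis m_closed)
    also have "\<dots> \<in> L"
      using L(3)[OF minus[OF L(4)[OF _ e(1), of x]] x] x L(1) by blast
    finally have "x \<otimes> e' = \<zero>" using xe' L'(2) by blast
    then have "x \<otimes> e \<oplus> x \<otimes> e' = x \<otimes> e" using c by simp
    then show "x \<otimes> e = x" using eq by metis
  qed
qed

end

section \<open>Graded modules and injectivity\<close>

context gr_alg
begin

lemma zpart_int [simp]: "zpart A (int i) = gpart A i"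
  by (simp add: zpart_def)

lemma zpart_carrier: "x \<in> zpart A m \<Longrightarrow> x \<in> carrier A"
  using gpart_carrier by (auto simp: zpart_def split: if_splits)

lemma zpart_zero [simp]: "\<zero> \<in> zpart A m"
  by (simp add: zpart_def)

lemma zpart_add: "x \<in> zpart A m \<Longrightarrow> y \<in> zpart A m \<Longrightarrow> x \<oplus> y \<in> zpart A m"
  by (auto simp: zpart_def split: if_splits)

lemma zpart_mult:
  assumes "a \<in> gpart A i" "x \<in> zpart A m"
  shows "a \<otimes> x \<in> zpart A (m + int i)"
proof (cases "0 \<le> m")
  case True
  then have "nat (m + int i) = i + nat m" by simp
  then show ?thesis using assms True gpart_mult[of a i x "nat m"] by (simp add: zpart_def)
next
  case False
  then show ?thesis using assms gpart_carrier[OF assms(1)] by (simp add: zpart_def)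
qed

end

section \<open>Graded modules and annihilators of homogeneous elements\<close>

locale gr_mod = gr_alg K A for K :: "'k ring" and A :: "('k, 'a) gralg" (structure) +
  fixes M :: "('a, 'm) grmod"
  assumes gmod: "graded_module A M"

sublocale gr_mod \<subseteq> G: abelian_group "gcomp M j" for j
  using gmod by (simp add: graded_module_def)

context gr_mod
begin

lemma act_closed [simp]: "a \<in> gpart A i \<Longrightarrow> x \<in> el M j \<Longrightarrow> gact M i j a x \<in> el M (j + int i)"
  using gmod by (simp add: graded_module_def)

lemma act_add: "a \<in> gpart A i \<Longrightarrow> x \<in> el M j \<Longrightarrow> y \<in> el M j \<Longrightarrow>
    gact M i j a (x \<oplus>\<^bsub>gcomp M j\<^esub> y) = gact M i j a x \<oplus>\<^bsub>gcomp M (j + int i)\<^esub> gact M i j a y"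
  using gmod by (simp add: graded_module_def)

lemma act_ladd: "a \<in> gpart A i \<Longrightarrow> b \<in> gpart A i \<Longrightarrow> x \<in> el M j \<Longrightarrow>
    gact M i j (a \<oplus> b) x = gact M i j a x \<oplus>\<^bsub>gcomp M (j + int i)\<^esub> gact M i j b x"
  using gmod by (simp add: graded_module_def)

lemma act_mult: "a \<in> gpart A i \<Longrightarrow> b \<in> gpart A i' \<Longrightarrow> x \<in> el M j \<Longrightarrow>
    gact M (i + i') j (a \<otimes> b) x = gact M i (j + int i') a (gact M i' j b x)"
  using gmod by (simp add: graded_module_def)

lemma act_one [simp]: "x \<in> el M j \<Longrightarrow> gact M 0 j \<one> x = x"
  using gmod by (simp add: graded_module_def)

lemma act_zero [simp]:
  assumes "a \<in> gpart A i"
  shows "gact M i j a \<zero>\<^bsub>gcomp M j\<^esub> = \<zero>\<^bsub>gcomp M (j + int i)\<^esub>"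
  using act_add[OF assms, of "\<zero>\<^bsub>gcomp M j\<^esub>" j "\<zero>\<^bsub>gcomp M j\<^esub>"] assms
  by (simp add: G.add.l_cancel_one)

lemma act_lzero [simp]:
  assumes "x \<in> el M j"
  shows "gact M i j \<zero> x = \<zero>\<^bsub>gcomp M (j + int i)\<^esub>"
  using act_ladd[of \<zero> i \<zero> x j] assms by (simp add: G.add.l_cancel_one)

lemma act_neg:
  assumes "a \<in> gpart A i" "x \<in> el M j"
  shows "gact M i j a (\<ominus>\<^bsub>gcomp M j\<^esub> x) = \<ominus>\<^bsub>gcomp M (j + int i)\<^esub> gact M i j a x"
proof (rule G.minus_equality[symmetric])
  have "gact M i j a (\<ominus>\<^bsub>gcomp M j\<^esub> x \<oplus>\<^bsub>gcomp M j\<^esub> x) = \<zero>\<^bsub>gcomp M (j + int i)\<^esub>"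
    using assms by (simp add: G.l_neg)
  then show "gact M i j a (\<ominus>\<^bsub>gcomp M j\<^esub> x) \<oplus>\<^bsub>gcomp M (j + int i)\<^esub> gact M i j a x
      = \<zero>\<^bsub>gcomp M (j + int i)\<^esub>"
    using assms act_add[of a i "\<ominus>\<^bsub>gcomp M j\<^esub> x" j x] by simp
qed (use assms in auto)

lemma act_minus: "a \<in> gpart A i \<Longrightarrow> x \<in> el M j \<Longrightarrow> y \<in> el M j \<Longrightarrow>
    gact M i j a (x \<ominus>\<^bsub>gcomp M j\<^esub> y) = gact M i j a x \<ominus>\<^bsub>gcomp M (j + int i)\<^esub> gact M i j a y"
  by (simp add: a_minus_def act_add act_neg)

definition ann :: "int \<Rightarrow> 'm \<Rightarrow> nat \<Rightarrow> 'a set" where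
  "ann j x i = {a \<in> gpart A i. gact M i j a x = \<zero>\<^bsub>gcomp M (j + int i)\<^esub>}"

lemma annI: "a \<in> gpart A i \<Longrightarrow> gact M i j a x = \<zero>\<^bsub>gcomp M (j + int i)\<^esub> \<Longrightarrow> a \<in> ann j x i"
  and annD: "a \<in> ann j x i \<Longrightarrow> a \<in> gpart A i"
    "a \<in> ann j x i \<Longrightarrow> gact M i j a x = \<zero>\<^bsub>gcomp M (j + int i)\<^esub>"
  by (simp_all add: ann_def)

lemma ann_zero [simp]: "ann j \<zero>\<^bsub>gcomp M j\<^esub> i = gpart A i"
  by (auto simp: ann_def)

lemma ann_mult:
  assumes "x \<in> el M j" "a \<in> gpart A i" "b \<in> ann j x i'"
  shows "a \<otimes> b \<in> ann j x (i + i')"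
  using act_mult[of a i b i' x j] assms annD[OF assms(3)]
  by (intro annI) (auto simp: ac_simps)

lemma graded_family_ann:
  assumes "x \<in> el M j"
  shows "graded_family (ann j x)"
  unfolding graded_family_def
  using assms ann_mult[OF assms] by (auto simp: ann_def act_ladd)

text \<open>By associativity ann(k x) is the colon ideal of ann x by k. This turns the
  well-definedness of extensions into a containment of annihilators, and it shows that multiples of
  top degree lie in the socle.\<close>

lemma ann_act_iff:
  assumes "x \<in> el M j" "k \<in> gpart A e" "a \<in> gpart A i"
  shows "a \<in> ann (j + int e) (gact M e j k x) i \<longleftrightarrow> a \<otimes> k \<in> ann j x (i + e)"
  using act_mult[of a i k e x j] gpart_mult[OF assms(3,2)] assms by (auto simp: ann_def add.assoc add.commute[of "int e"])

lemma ann_neg: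
  assumes "x \<in> el M j"
  shows "ann j x i \<subseteq> ann j (\<ominus>\<^bsub>gcomp M j\<^esub> x) i"
  using assms by (auto simp: ann_def act_neg)

lemma ann_minus:
  assumes "x \<in> el M j" "y \<in> el M j" "a \<in> ann j x i" "a \<in> ann j y i"
  shows "a \<in> ann j (x \<ominus>\<^bsub>gcomp M j\<^esub> y) i"
  using assms annD[OF assms(3)] annD[OF assms(4)]
  by (intro annI) (simp_all only: act_minus, simp add: a_minus_def)

lemma ann_add:
  assumes "x \<in> el M j" "y \<in> el M j" "a \<in> ann j x i" "a \<in> ann j y i"
  shows "a \<in> ann j (x \<oplus>\<^bsub>gcomp M j\<^esub> y) i"
  using assms annD[OF assms(3)] annD[OF assms(4)]
  by (intro annI) (simp_all add: act_add)

lemma torsion_iff_ann: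
  "x \<in> torsion (gpart A) M j \<longleftrightarrow> x \<in> el M j \<and> (\<exists>n. \<forall>i\<ge>n. gpart A i \<subseteq> ann j x i)"
  by (auto simp: torsion_def ann_def)

end

lemma mk_grp_simps [simp]:
  "carrier (mk_grp S z f) = S" "zero (mk_grp S z f) = z" "add (mk_grp S z f) = f"
  by (simp_all add: mk_grp_def)

section \<open>Injective modules and Baer's criterion\<close>

locale inj_mod = gr_mod K A M
  for K :: "'k ring" and A :: "('k, 'a) gralg" (structure) and M :: "('a, ('a, 'x) res) grmod" +
  fixes c0 c1 :: 'x
  assumes inj: "injective_obj (gpart A) (graded_module A) M"
    and two: "c0 \<noteq> c1"
begin

text \<open>Injectivity of \<open>M\<close> is only tested on modules with the same carrier type, so \<open>A\<close> is
  embedded into that type.\<close>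

definition enc :: "'a \<Rightarrow> ('a, 'x) res" where
  "enc a = (\<lambda>(b, n). if b = a then c1 else c0)"

lemma inj_enc: "inj enc"
proof (rule injI)
  fix a b assume "enc a = enc b"
  then have "enc a (a, 0) = enc b (a, 0)" by simp
  then show "a = b" using two by (simp add: enc_def split: if_splits)
qed

definition dec :: "('a, 'x) res \<Rightarrow> 'a" where "dec = inv_into UNIV enc"

lemma dec_enc [simp]: "dec (enc a) = a"
  by (simp add: dec_def inv_f_f[OF inj_enc])

lemma enc_eq [simp]: "enc a = enc b \<longleftrightarrow> a = b"
  using inj_enc by (auto dest: injD)

text \<open>Meant for the shift of \<open>A\<close> with components A_{m-j} and for its graded
  submodules, copied into the carrier type on which injectivity is tested.\<close>

definition enc_mod :: "(int \<Rightarrow> 'a set) \<Rightarrow> ('a, ('a, 'x) res) grmod" where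
  "enc_mod D = \<lparr>gcomp = (\<lambda>m. mk_grp (enc ` D m) (enc \<zero>) (\<lambda>x y. enc (dec x \<oplus> dec y))),
     gact = (\<lambda>i m a x. enc (a \<otimes> dec x))\<rparr>"

lemma graded_module_enc_mod:
  assumes "\<And>m. D m \<subseteq> carrier A" "\<And>m. \<zero> \<in> D m"
    and "\<And>m x y. x \<in> D m \<Longrightarrow> y \<in> D m \<Longrightarrow> x \<oplus> y \<in> D m"
    and mult: "\<And>m i a x. a \<in> gpart A i \<Longrightarrow> x \<in> D m \<Longrightarrow> a \<otimes> x \<in> D (m + int i)"
  shows "graded_module A (enc_mod D)"
proof -
  have c: "\<And>m x. x \<in> D m \<Longrightarrow> x \<in> carrier A" using assms(1) by auto
  have neg: "\<ominus> x \<in> D m" if "x \<in> D m" for x m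
  proof -
    have "\<ominus> x = (\<ominus> \<one>) \<otimes> x" using c[OF that] by (simp add: l_minus)
    then show ?thesis using mult[OF _ that, of "\<ominus> \<one>" 0] by simp
  qed
  have "abelian_group (gcomp (enc_mod D) m)" for m
  proof (rule abelian_groupI)
    fix x assume "x \<in> carrier (gcomp (enc_mod D) m)"
    then obtain a where "x = enc a" "a \<in> D m" by (auto simp: enc_mod_def)
    then show "\<exists>y\<in>carrier (gcomp (enc_mod D) m).
        y \<oplus>\<^bsub>gcomp (enc_mod D) m\<^esub> x = \<zero>\<^bsub>gcomp (enc_mod D) m\<^esub>"
      using neg[of a m] c by (auto simp: enc_mod_def intro!: bexI[of _ "\<ominus> a"] l_neg)
  qed (use assms(2,3) c in \<open>auto simp: enc_mod_def a_ac\<close>)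
  then show ?thesis
    using assms(2,3) mult c gpart_carrier
    unfolding graded_module_def by (auto simp: enc_mod_def r_distr l_distr m_assoc)
qed

text \<open>A homomorphism from a graded left ideal to \<open>M\<close> is given by its graph \<open>Rel\<close>.\<close>

lemma baer:
  assumes R_in: "\<And>i c t. Rel i c t \<Longrightarrow> c \<in> gpart A i \<and> t \<in> el M (j + int i)"
    and R_zero: "\<And>i. Rel i \<zero> \<zero>\<^bsub>gcomp M (j + int i)\<^esub>"
    and R_add: "\<And>i c t c' t'. Rel i c t \<Longrightarrow> Rel i c' t' \<Longrightarrow>
      Rel i (c \<oplus> c') (t \<oplus>\<^bsub>gcomp M (j + int i)\<^esub> t')"
    and R_act: "\<And>i i' a c t. a \<in> gpart A i \<Longrightarrow> Rel i' c t \<Longrightarrow>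
      Rel (i + i') (a \<otimes> c) (gact M i (j + int i') a t)"
    and R_fun: "\<And>i t. Rel i \<zero> t \<Longrightarrow> t = \<zero>\<^bsub>gcomp M (j + int i)\<^esub>"
  obtains w where "w \<in> el M j" "\<And>i c t. Rel i c t \<Longrightarrow> gact M i j c w = t"
proof -
  \<comment> \<open>\<open>Rel\<close> is indexed by degrees in \<open>A\<close>. \<open>Z\<close>
    is the same graph reindexed by degrees of the shift of \<open>A\<close> whose generator 1 sits
    in degree \<open>j\<close>, and it is the zero graph below \<open>j\<close>.\<close>
  define Z where "Z m c t \<longleftrightarrow> (if j \<le> m then Rel (nat (m - j)) c t
      else c = \<zero> \<and> t = \<zero>\<^bsub>gcomp M m\<^esub>)" for m c t
  have Z_int: "Z (j + int i) c t \<longleftrightarrow> Rel i c t" for i c t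
    by (simp add: Z_def)
  have Z_cases: "(\<exists>i. m = j + int i) \<or> m < j" for m
    by (metis add_diff_cancel_left' le_add_diff_inverse linorder_not_less zle_iff_zadd)
  have Z_in: "c \<in> zpart A (m - j)" "t \<in> el M m" if "Z m c t" for m c t
    using Z_cases[of m] that R_in by (auto simp: Z_int) (auto simp: Z_def)
  have Z_zero: "Z m \<zero> \<zero>\<^bsub>gcomp M m\<^esub>" for m
    using Z_cases[of m] R_zero by (auto simp: Z_int) (auto simp: Z_def)
  have Z_add: "Z m (c \<oplus> c') (t \<oplus>\<^bsub>gcomp M m\<^esub> t')" if "Z m c t" "Z m c' t'" for m c c' t t'
    using Z_cases[of m] that R_add by (auto simp: Z_int) (auto simp: Z_def)
  have Z_act: "Z (m + int i) (a \<otimes> c) (gact M i m a t)" if a: "a \<in> gpart A i" and Z: "Z m c t" for m i a c t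
  proof (cases "m < j")
    case True
    then show ?thesis using Z Z_zero[of "m + int i"] a gpart_carrier[OF a] by (simp add: Z_def)
  next
    case False
    then obtain i' where m: "m = j + int i'" using Z_cases by auto
    have "j + int i' + int i = j + int (i + i')" by simp
    then show ?thesis using Z R_act[OF a, of i' c t] Z_int unfolding m by metis
  qed
  \<comment> \<open>Negation is the action of -1, so closure under the action already gives closure
    under negatives.\<close>
  have Z_neg: "Z m (\<ominus> c) (\<ominus>\<^bsub>gcomp M m\<^esub> t)" if Z: "Z m c t" for m c t
  proof -
    have "gact M 0 m (\<ominus> \<one>) t \<oplus>\<^bsub>gcomp M m\<^esub> t = gact M 0 m (\<ominus> \<one> \<oplus> \<one>) t"
      using Z_in(2)[OF Z] act_ladd[of "\<ominus> \<one>" 0 \<one> t m] by simp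
    then have "gact M 0 m (\<ominus> \<one>) t \<oplus>\<^bsub>gcomp M m\<^esub> t = \<zero>\<^bsub>gcomp M m\<^esub>"
      using Z_in(2)[OF Z] by (simp add: l_neg)
    then have "\<ominus>\<^bsub>gcomp M m\<^esub> t = gact M 0 m (\<ominus> \<one>) t"
      using Z_in(2)[OF Z] act_closed[of "\<ominus> \<one>" 0 t m] by (intro G.minus_equality) auto
    moreover have "\<ominus> c = (\<ominus> \<one>) \<otimes> c"
      using zpart_carrier[OF Z_in(1)[OF Z]] by (simp add: l_minus)
    ultimately show ?thesis using Z_act[OF _ Z, of "\<ominus> \<one>" 0] by simp
  qed
  \<comment> \<open>Being closed under differences, the graph is single-valued as soon as it is so
    over 0, which is \<open>R_fun\<close>.\<close>
  have Z_fun: "t = t'" if Z: "Z m c t" "Z m c t'" for m c t t'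
  proof -
    have "Z m \<zero> (t \<oplus>\<^bsub>gcomp M m\<^esub> \<ominus>\<^bsub>gcomp M m\<^esub> t')"
      using Z_add[OF Z(1) Z_neg[OF Z(2)]] zpart_carrier[OF Z_in(1)[OF Z(1)]] by (simp add: r_neg)
    then have "t \<oplus>\<^bsub>gcomp M m\<^esub> \<ominus>\<^bsub>gcomp M m\<^esub> t' = \<zero>\<^bsub>gcomp M m\<^esub>"
      using Z_cases[of m] R_fun by (auto simp: Z_int) (auto simp: Z_def)
    then have "\<ominus>\<^bsub>gcomp M m\<^esub> (\<ominus>\<^bsub>gcomp M m\<^esub> t') = t"
      using Z_in(2)[OF Z(1)] Z_in(2)[OF Z(2)] by (intro G.minus_equality) auto
    then show ?thesis using Z_in(2)[OF Z(2)] by simp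
  qed
  define D where "D m = {c. \<exists>t. Z m c t}" for m
  define D' where "D' m = zpart A (m - j)" for m
  define f where "f m = (\<lambda>x\<in>enc ` D m. THE t. Z m (dec x) t)" for m
  have f_enc: "f m (enc c) = t" if "Z m c t" for m c t
    using that Z_fun unfolding f_def D_def by (auto intro!: the_equality)
  have DD': "D m \<subseteq> D' m" for m using Z_in(1) by (auto simp: D_def D'_def)
  have D_add: "c \<oplus> c' \<in> D m" if "c \<in> D m" "c' \<in> D m" for m c c'
    using that Z_add unfolding D_def by blast
  have D_mult: "a \<otimes> c \<in> D (m + int i)" if "a \<in> gpart A i" "c \<in> D m" for m i a c
    using that Z_act unfolding D_def by blast
  have gD: "graded_module A (enc_mod D)"
  proof (rule graded_module_enc_mod)
    show "D m \<subseteq> carrier A" for m using zpart_carrier[OF Z_in(1)] by (auto simp: D_def)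
    show "\<zero> \<in> D m" for m using Z_zero by (auto simp: D_def)
  qed (fact D_add D_mult)+
  have gD': "graded_module A (enc_mod D')"
  proof (rule graded_module_enc_mod)
    show "a \<otimes> x \<in> D' (m + int i)" if "a \<in> gpart A i" "x \<in> D' m" for m i a x
      using zpart_mult[OF that(1), of x "m - j"] that(2) by (simp add: D'_def algebra_simps)
  qed (auto simp: D'_def zpart_carrier zpart_add)
  have fD: "f \<in> ghom (gpart A) (enc_mod D) M"
    unfolding ghom_def
  proof (intro CollectI conjI allI ballI IntI)
    show "f m \<in> extensional (el (enc_mod D) m)" for m
      by (simp add: f_def enc_mod_def)
    show "f m \<in> hom (add_monoid (gcomp (enc_mod D) m)) (add_monoid (gcomp M m))" for m
    proof (rule homI)
      fix x assume "x \<in> carrier (add_monoid (gcomp (enc_mod D) m))"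
      then obtain c t where x: "x = enc c" "Z m c t" by (auto simp: enc_mod_def D_def)
      then show "f m x \<in> carrier (add_monoid (gcomp M m))" using Z_in(2) f_enc by auto
      fix y assume "y \<in> carrier (add_monoid (gcomp (enc_mod D) m))"
      then obtain c' t' where y: "y = enc c'" "Z m c' t'" by (auto simp: enc_mod_def D_def)
      then show "f m (x \<otimes>\<^bsub>add_monoid (gcomp (enc_mod D) m)\<^esub> y)
          = f m x \<otimes>\<^bsub>add_monoid (gcomp M m)\<^esub> f m y"
        using f_enc[OF x(2)] f_enc[OF y(2)] f_enc[OF Z_add[OF x(2) y(2)]] x(1)
        by (simp add: enc_mod_def)
    qed
    fix i m a x assume a: "a \<in> gpart A i" and "x \<in> el (enc_mod D) m"
    then obtain c t where x: "x = enc c" "Z m c t" by (auto simp: enc_mod_def D_def)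
    then show "f (m + int i) (gact (enc_mod D) i m a x) = gact M i m a (f m x)"
      using f_enc[OF Z_act[OF a x(2)]] f_enc[OF x(2)] by (simp add: enc_mod_def)
  qed
  \<comment> \<open>The inclusion of the domain of the partial map into the shift of
    \<open>A\<close>. Injectivity is applied to this monomorphism.\<close>
  define u where "u m = (\<lambda>x\<in>enc ` D m. x)" for m
  have uD: "u \<in> ghom (gpart A) (enc_mod D) (enc_mod D')"
    unfolding ghom_def
  proof (intro CollectI conjI allI ballI IntI)
    show "u m \<in> extensional (el (enc_mod D) m)" for m
      by (simp add: u_def enc_mod_def)
    show "u m \<in> hom (add_monoid (gcomp (enc_mod D) m)) (add_monoid (gcomp (enc_mod D') m))" for m
      using subsetD[OF DD'[of m]] D_add[of _ m] by (auto intro!: homI imageI simp: u_def enc_mod_def)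
    show "u (m + int i) (gact (enc_mod D) i m a x) = gact (enc_mod D') i m a (u m x)"
      if "a \<in> gpart A i" "x \<in> el (enc_mod D) m" for m i a x
      using that D_mult by (auto simp: u_def enc_mod_def)
  qed
  have inj_u: "\<forall>m. inj_on (u m) (el (enc_mod D) m)" by (auto simp: inj_on_def u_def enc_mod_def)
  have "graded_module A (enc_mod D) \<and> graded_module A (enc_mod D') \<and>
      (\<forall>m. inj_on (u m) (el (enc_mod D) m)) \<longrightarrow>
      (\<exists>g\<in>ghom (gpart A) (enc_mod D') M. \<forall>m. \<forall>x\<in>el (enc_mod D) m. g m (u m x) = f m x)"
    using inj[unfolded injective_obj_def, THEN conjunct2, rule_format, OF uD fD] by simp
  then obtain g where g: "g \<in> ghom (gpart A) (enc_mod D') M"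
      "\<And>m x. x \<in> el (enc_mod D) m \<Longrightarrow> g m (u m x) = f m x"
    using gD gD' inj_u by auto
  have one: "enc \<one> \<in> el (enc_mod D') j" by (simp add: enc_mod_def D'_def zpart_def)
  have g_hom: "g m \<in> hom (add_monoid (gcomp (enc_mod D') m)) (add_monoid (gcomp M m))"
    and g_act: "a \<in> gpart A i \<Longrightarrow> x \<in> el (enc_mod D') m \<Longrightarrow>
      g (m + int i) (gact (enc_mod D') i m a x) = gact M i m a (g m x)" for m i a x
    using g(1) by (auto simp: ghom_def)
  \<comment> \<open>The witness is the image of 1, since the extension sends c = c 1 to c times that
    image.\<close>
  show thesis
  proof
    show "g j (enc \<one>) \<in> el M j" using hom_in_carrier[OF g_hom, of "enc \<one>" j] one by simp
    fix i c t assume R: "Rel i c t"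
    then have Z: "Z (j + int i) c t" and c: "c \<in> gpart A i" using Z_int R_in by auto
    have "gact M i j c (g j (enc \<one>)) = g (j + int i) (enc c)"
      using g_act[OF c one] gpart_carrier[OF c] by (simp add: enc_mod_def)
    also have "\<dots> = t"
      using g(2)[of "enc c" "j + int i"] f_enc[OF Z] Z by (auto simp: u_def enc_mod_def D_def)
    finally show "gact M i j c (g j (enc \<one>)) = t" .
  qed
qed

text \<open>Baer's criterion for the map x + a k -> a v on L + A k. The hypothesis
  \<open>ann\<close> is its well-definedness: whenever a k falls into \<open>L\<close>, where the
  map is zero, a v must vanish.\<close>

lemma extend:
  assumes L: "graded_family L" and k: "k \<in> gpart A e" and v: "v \<in> el M (j + int e)"
    and ann: "\<And>i a. a \<in> gpart A i \<Longrightarrow> a \<otimes> k \<in> L (i + e) \<Longrightarrow> a \<in> ann (j + int e) v i"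
  obtains w where "w \<in> el M j" "\<And>i. L i \<subseteq> ann j w i" "gact M e j k w = v"
proof -
  have Lg: "\<And>i x. x \<in> L i \<Longrightarrow> x \<in> gpart A i" and L0: "\<And>i. \<zero> \<in> L i"
    and Ladd: "\<And>i x y. x \<in> L i \<Longrightarrow> y \<in> L i \<Longrightarrow> x \<oplus> y \<in> L i"
    and Lmult: "\<And>i j a x. a \<in> gpart A i \<Longrightarrow> x \<in> L j \<Longrightarrow> a \<otimes> x \<in> L (i + j)"
    using L by (auto simp: graded_family_def)
  have Lc: "x \<in> carrier A" if "x \<in> L i" for x i using gpart_carrier[OF Lg[OF that]] .
  have kc: "k \<in> carrier A" using gpart_carrier[OF k] .
  have idx: "j + int (d + e) = j + int e + int d" for d by simp
  \<comment> \<open>In degrees below \<open>e\<close> there are no elements a k. As degrees are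
    natural numbers, the elements of \<open>L\<close> there need a disjunct of their own.\<close>
  define Rel where "Rel i c t \<longleftrightarrow> (c \<in> L i \<and> t = \<zero>\<^bsub>gcomp M (j + int i)\<^esub>) \<or>
      (\<exists>x d a. x \<in> L i \<and> i = d + e \<and> a \<in> gpart A d \<and> c = x \<oplus> a \<otimes> k \<and>
         t = gact M d (j + int e) a v)" for i c t
  have RelI: "Rel (d + e) (x \<oplus> a \<otimes> k) (gact M d (j + int e) a v)"
    if "x \<in> L (d + e)" "a \<in> gpart A d" for x d a
    using that unfolding Rel_def by blast
  have RelI0: "Rel i c \<zero>\<^bsub>gcomp M (j + int i)\<^esub>" if "c \<in> L i" for i c
    using that unfolding Rel_def by blast
  have in_carrier: "c \<in> gpart A i" "t \<in> el M (j + int i)" if "Rel i c t" for i c t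
  proof -
    show "c \<in> gpart A i" using that Lg k by (auto simp: Rel_def)
    show "t \<in> el M (j + int i)" using that act_closed[OF _ v] unfolding Rel_def idx by (auto simp: add.assoc add.commute[of "int e"])
  qed
  have mixed: "Rel i (c \<oplus> c') (t \<oplus>\<^bsub>gcomp M (j + int i)\<^esub> t')"
    if "c \<in> L i" "t = \<zero>\<^bsub>gcomp M (j + int i)\<^esub>" "Rel i c' t'" for i c t c' t'
  proof -
    have t': "t \<oplus>\<^bsub>gcomp M (j + int i)\<^esub> t' = t'" using in_carrier[OF that(3)] that(2) by simp
    from that(3) consider "c' \<in> L i" "t' = \<zero>\<^bsub>gcomp M (j + int i)\<^esub>"
      | x d a where "x \<in> L i" "i = d + e" "a \<in> gpart A d" "c' = x \<oplus> a \<otimes> k" "t' = gact M d (j + int e) a v"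
      unfolding Rel_def by blast
    then show ?thesis
    proof cases
      case 1
      then show ?thesis using RelI0[of "c \<oplus> c'" i] Ladd that(1) t' by simp
    next
      case 2
      have "c \<oplus> c' = c \<oplus> x \<oplus> a \<otimes> k"
        using Lc[OF that(1)] Lc[OF 2(1)] gpart_carrier[OF 2(3)] kc 2(4) by (simp add: a_assoc)
      then show ?thesis using RelI[of "c \<oplus> x" d a] Ladd[of c i x] 2 that(1) t' by simp
    qed
  qed
  obtain w where w: "w \<in> el M j" "\<And>i c t. Rel i c t \<Longrightarrow> gact M i j c w = t"
  proof (rule baer[of Rel j])
    show "Rel i \<zero> \<zero>\<^bsub>gcomp M (j + int i)\<^esub>" for i using RelI0 L0 by blast
  next
    fix i c t c' t'
    assume R: "Rel i c t" "Rel i c' t'"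
    show "Rel i (c \<oplus> c') (t \<oplus>\<^bsub>gcomp M (j + int i)\<^esub> t')"
    proof (cases "(c \<in> L i \<and> t = \<zero>\<^bsub>gcomp M (j + int i)\<^esub>) \<or> (c' \<in> L i \<and> t' = \<zero>\<^bsub>gcomp M (j + int i)\<^esub>)")
      case True
      have "c \<in> carrier A" "c' \<in> carrier A" using in_carrier R gpart_carrier by blast+
      then have "c \<oplus> c' = c' \<oplus> c" "t \<oplus>\<^bsub>gcomp M (j + int i)\<^esub> t' = t' \<oplus>\<^bsub>gcomp M (j + int i)\<^esub> t"
        using in_carrier(2)[OF R(1)] in_carrier(2)[OF R(2)] by (simp_all add: a_comm G.a_comm)
      then show ?thesis using True mixed R by metis
    next
      case False
      then obtain x d a x' a' where *: "x \<in> L i" "i = d + e" "a \<in> gpart A d" "c = x \<oplus> a \<otimes> k"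
        "t = gact M d (j + int e) a v" "x' \<in> L i" "a' \<in> gpart A d" "c' = x' \<oplus> a' \<otimes> k"
        "t' = gact M d (j + int e) a' v"
        using R unfolding Rel_def by (metis add_right_cancel)
      have "c \<oplus> c' = (x \<oplus> x') \<oplus> (a \<oplus> a') \<otimes> k"
        using Lc[OF *(1)] Lc[OF *(6)] gpart_carrier[OF *(3)] gpart_carrier[OF *(7)] kc *(4,8)
        by (simp add: l_distr a_ac)
      moreover have "t \<oplus>\<^bsub>gcomp M (j + int i)\<^esub> t' = gact M d (j + int e) (a \<oplus> a') v"
        using * v unfolding \<open>i = d + e\<close> idx by (simp add: act_ladd)
      ultimately show ?thesis using RelI[of "x \<oplus> x'" d "a \<oplus> a'"] Ladd * by simp
    qed
  next
    fix i i' a c t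
    assume a: "a \<in> gpart A i" and R: "Rel i' c t"
    from R consider "c \<in> L i'" "t = \<zero>\<^bsub>gcomp M (j + int i')\<^esub>"
      | x d b where "x \<in> L i'" "i' = d + e" "b \<in> gpart A d" "c = x \<oplus> b \<otimes> k" "t = gact M d (j + int e) b v"
      unfolding Rel_def by blast
    then show "Rel (i + i') (a \<otimes> c) (gact M i (j + int i') a t)"
    proof cases
      case 1
      then show ?thesis using RelI0[OF Lmult[OF a, of c i']] a by (simp add: add.assoc add.commute[of "int i'"])
    next
      case 2
      have "a \<otimes> c = a \<otimes> x \<oplus> (a \<otimes> b) \<otimes> k"
        using Lc[OF 2(1)] gpart_carrier[OF 2(3)] gpart_carrier[OF a] kc 2(4)
        by (simp add: r_distr m_assoc)
      moreover have "gact M i (j + int i') a t = gact M (i + d) (j + int e) (a \<otimes> b) v"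
        using act_mult[OF a 2(3) v] 2 by (simp add: add.assoc add.commute[of "int e"])
      ultimately show ?thesis
        using RelI[of "a \<otimes> x" "i + d" "a \<otimes> b"] Lmult[OF a 2(1)] 2 a by (simp add: add.assoc)
    qed
  next
    fix i t
    assume "Rel i \<zero> t"
    then consider "t = \<zero>\<^bsub>gcomp M (j + int i)\<^esub>"
      | x d a where "x \<in> L i" "i = d + e" "a \<in> gpart A d" "\<zero> = x \<oplus> a \<otimes> k" "t = gact M d (j + int e) a v"
      unfolding Rel_def by blast
    then show "t = \<zero>\<^bsub>gcomp M (j + int i)\<^esub>"
    proof cases
      case 2
      have xc: "x \<in> carrier A" "a \<in> carrier A" using Lc[OF 2(1)] gpart_carrier[OF 2(3)] .
      have "a \<otimes> k = \<ominus> x"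
        using 2(4) xc kc a_comm[of x "a \<otimes> k"] by (intro minus_equality[symmetric]) auto
      also have "\<dots> = (\<ominus> \<one>) \<otimes> x" using xc by (simp add: l_minus)
      also have "\<dots> \<in> L (d + e)" using Lmult[of "\<ominus> \<one>" 0 x i] 2 by simp
      finally have "a \<in> ann (j + int e) v d" using ann 2 by blast
      then show ?thesis using annD(2) 2 by (simp add: add.assoc add.commute[of "int e"])
    qed simp
  qed (use in_carrier in auto)
  show thesis
  proof
    show "w \<in> el M j" by fact
    show "L i \<subseteq> ann j w i" for i using w(2)[OF RelI0] Lg by (auto intro: annI)
    have "Rel (0 + e) (\<zero> \<oplus> \<one> \<otimes> k) (gact M 0 (j + int e) \<one> v)" by (rule RelI) (auto simp: L0)
    then show "gact M e j k w = v" using w(2) v kc by simp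
  qed
qed

end

section \<open>The graded Jacobson radical and the module \<open>S\<close>\<close>

context gr_alg
begin

lemma left_idealD:
  assumes "left_ideal A L"
  shows "x \<in> L \<Longrightarrow> x \<in> carrier A" "\<zero> \<in> L" "x \<in> L \<Longrightarrow> y \<in> L \<Longrightarrow> x \<oplus> y \<in> L"
    "a \<in> carrier A \<Longrightarrow> x \<in> L \<Longrightarrow> a \<otimes> x \<in> L"
proof -
  have L: "additive_subgroup L A" "\<And>a x. a \<in> carrier A \<Longrightarrow> x \<in> L \<Longrightarrow> a \<otimes> x \<in> L"
    using assms by (simp_all add: left_ideal_def)
  show "x \<in> L \<Longrightarrow> x \<in> carrier A" using additive_subgroup.a_subset[OF L(1)] by (rule subsetD)
  show "\<zero> \<in> L" using L(1) by (rule additive_subgroup.zero_closed)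
  show "x \<in> L \<Longrightarrow> y \<in> L \<Longrightarrow> x \<oplus> y \<in> L" using L(1) by (rule additive_subgroup.a_closed)
  show "a \<in> carrier A \<Longrightarrow> x \<in> L \<Longrightarrow> a \<otimes> x \<in> L" by (rule L(2))
qed

lemma left_ideal_eq_carrier: "left_ideal A L \<Longrightarrow> \<one> \<in> L \<Longrightarrow> L = carrier A"
  using left_idealD(1)[of L] left_idealD(4)[of L _ \<one>] by force

text \<open>Enlarging a maximal graded left ideal by everything of positive degree keeps it proper,
  since its degree 0 part is unchanged and still misses 1. By maximality nothing was added.\<close>

lemma positive_part_subset_Jacobson:
  assumes i: "i > 0"
  shows "gpart A i \<subseteq> graded_Jacobson A"
proof -
  have "gpart A i \<subseteq> L" if max: "maximal_graded_left_ideal A L" for L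
  proof -
    have gL: "graded_left_ideal A L" and neq: "L \<noteq> carrier A"
      using max by (auto simp: maximal_graded_left_ideal_def)
    then have L: "left_ideal A L" by (simp add: graded_left_ideal_def)
    define F where "F n = (if n = 0 then L \<inter> gpart A 0 else gpart A n)" for n :: nat
    have F: "graded_family F"
      unfolding graded_family_def F_def
      using left_idealD[OF L] gpart_carrier gpart_mult by (auto simp: gpart_mult_zero)
    have "L \<subseteq> family_sum F"
    proof
      fix y assume y: "y \<in> L"
      obtain f where f: "is_decomp A y f" using is_decomp_exists[OF left_idealD(1)[OF L y]] ..
      then have "f n \<in> L" for n using gL y by (simp add: graded_left_ideal_def)
      then have "f n \<in> F n" for n using is_decomp_part[OF f, of n] by (auto simp: F_def)
      then show "y \<in> family_sum F" using f by (auto simp: family_sum_def)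
    qed
    then have "family_sum F = L \<or> family_sum F = carrier A"
      using max graded_left_ideal_family_sum[OF F] by (auto simp: maximal_graded_left_ideal_def)
    moreover have "family_sum F \<noteq> carrier A"
    proof
      assume "family_sum F = carrier A"
      then have "\<one> \<in> F 0" using family_sum_homog[OF F, of \<one> 0] by simp
      then show False using neq left_ideal_eq_carrier[OF L] by (simp add: F_def)
    qed
    ultimately show ?thesis using family_sum_homog[OF F, of _ i] i by (auto simp: F_def)
  qed
  then show ?thesis using gpart_carrier by (auto simp: graded_Jacobson_def)
qed

text \<open>Zorn's lemma, with properness expressed as not containing 1, a condition that survives
  unions of chains.\<close>

lemma exists_maximal_graded_left_ideal:
  assumes L: "graded_left_ideal A L" "\<one> \<notin> L"
  obtains L' where "maximal_graded_left_ideal A L'" "L \<subseteq> L'"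
proof -
  define \<A> where "\<A> = {L'. graded_left_ideal A L' \<and> L \<subseteq> L' \<and> \<one> \<notin> L'}"
  have "\<exists>M\<in>\<A>. \<forall>X\<in>\<A>. M \<subseteq> X \<longrightarrow> X = M"
  proof (rule subset_Zorn_nonempty)
    show "\<A> \<noteq> {}" using L by (auto simp: \<A>_def)
    fix C assume ne: "C \<noteq> {}" and ch: "subset.chain \<A> C"
    have C: "graded_left_ideal A X" "left_ideal A X" "L \<subseteq> X" "\<one> \<notin> X" if "X \<in> C" for X
      using that ch by (auto simp: \<A>_def subset.chain_def graded_left_ideal_def)
    obtain X0 where X0: "X0 \<in> C" using ne by blast
    have "left_ideal A (\<Union>C)"
    proof (rule left_idealI)
      show "\<Union>C \<subseteq> carrier A" using left_idealD(1)[OF C(2)] by blast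
      show "\<zero> \<in> \<Union>C" using left_idealD(2)[OF C(2)[OF X0]] X0 by blast
      show "a \<otimes> x \<in> \<Union>C" if "a \<in> carrier A" "x \<in> \<Union>C" for a x
        using that left_idealD(4)[OF C(2)] by blast
      fix x y assume "x \<in> \<Union>C" "y \<in> \<Union>C"
      then obtain X Y where XY: "X \<in> C" "x \<in> X" "Y \<in> C" "y \<in> Y" by blast
      then have "X \<subseteq> Y \<or> Y \<subseteq> X" using ch by (auto simp: subset.chain_def)
      then obtain Z where "Z \<in> C" "x \<in> Z" "y \<in> Z" using XY by blast
      then show "x \<oplus> y \<in> \<Union>C" using left_idealD(3)[OF C(2)] by blast
    qed
    then have "graded_left_ideal A (\<Union>C)"
      using C(1) unfolding graded_left_ideal_def by (meson Union_iff)
    then show "\<Union>C \<in> \<A>" using C(3)[OF X0] C(4) X0 by (auto simp: \<A>_def)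
  qed
  then obtain M where M: "M \<in> \<A>" "\<And>X. X \<in> \<A> \<Longrightarrow> M \<subseteq> X \<Longrightarrow> X = M" by blast
  have "L' = M \<or> L' = carrier A" if L': "graded_left_ideal A L'" "M \<subseteq> L'" for L'
  proof (cases "\<one> \<in> L'")
    case True
    then show ?thesis using L'(1) left_ideal_eq_carrier by (auto simp: graded_left_ideal_def)
  next
    case False
    then show ?thesis using L' M by (auto simp: \<A>_def)
  qed
  then have "maximal_graded_left_ideal A M"
    using M(1) by (auto simp: maximal_graded_left_ideal_def \<A>_def)
  then show thesis using that M(1) by (auto simp: \<A>_def)
qed

text \<open>A_0 x has an idempotent right identity e = a x, which lies in the radical together with
  x. If x is nonzero, so is e, and the complementary idempotent f = 1 - e lies in a maximal graded
  left ideal. That ideal also contains e, hence 1.\<close>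

lemma Jacobson_degree_zero:
  assumes ss: "semisimple_ring (A\<lparr>carrier := gpart A 0\<rparr>)"
    and x: "x \<in> graded_Jacobson A" "x \<in> gpart A 0"
  shows "x = \<zero>"
proof (rule ccontr)
  assume x0: "x \<noteq> \<zero>"
  have xc: "x \<in> carrier A" using gpart_carrier[OF x(2)] .
  obtain e where e: "e \<in> (\<lambda>a. a \<otimes> x) ` gpart A 0"
    "\<And>y. y \<in> (\<lambda>a. a \<otimes> x) ` gpart A 0 \<Longrightarrow> y \<otimes> e = y"
  proof (rule semisimple_idempotent[OF ss, of "(\<lambda>a. a \<otimes> x) ` gpart A 0"])
    show "(\<lambda>a. a \<otimes> x) ` gpart A 0 \<subseteq> gpart A 0" using x(2) gpart_mult_zero by blast
    show "\<zero> \<in> (\<lambda>a. a \<otimes> x) ` gpart A 0" using xc by (intro image_eqI[of _ _ \<zero>]) auto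
    show "y \<oplus> z \<in> (\<lambda>a. a \<otimes> x) ` gpart A 0"
      if "y \<in> (\<lambda>a. a \<otimes> x) ` gpart A 0" "z \<in> (\<lambda>a. a \<otimes> x) ` gpart A 0" for y z
    proof -
      from that obtain a b where "a \<in> gpart A 0" "b \<in> gpart A 0" "y = a \<otimes> x" "z = b \<otimes> x" by blast
      then show ?thesis using xc gpart_carrier by (intro image_eqI[of _ _ "a \<oplus> b"]) (auto simp: l_distr)
    qed
    show "a \<otimes> y \<in> (\<lambda>a. a \<otimes> x) ` gpart A 0"
      if "a \<in> gpart A 0" "y \<in> (\<lambda>a. a \<otimes> x) ` gpart A 0" for a y
    proof -
      from that obtain b where "b \<in> gpart A 0" "y = b \<otimes> x" by blast
      then show ?thesis using xc gpart_carrier that(1)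
        by (intro image_eqI[of _ _ "a \<otimes> b"]) (auto simp: m_assoc gpart_mult_zero)
    qed
  qed (rule that)
  obtain a where a: "a \<in> gpart A 0" "e = a \<otimes> x" using e(1) by blast
  have e0: "e \<in> gpart A 0" using a x(2) gpart_mult_zero by blast
  have ec: "e \<in> carrier A" and ac: "a \<in> carrier A" using gpart_carrier e0 a(1) by blast+
  have "x \<in> (\<lambda>a. a \<otimes> x) ` gpart A 0" using xc by (intro image_eqI[of _ _ \<one>]) auto
  then have xe: "x \<otimes> e = x" by (rule e(2))
  have ee: "e \<otimes> e = e" using e by blast
  define f where "f = \<one> \<ominus> e"
  have f0: "f \<in> gpart A 0" using e0 by (simp add: f_def a_minus_def)
  have fc: "f \<in> carrier A" using gpart_carrier f0 by blast
  have fe: "f \<otimes> e = \<zero>" using ec ee by (simp add: f_def a_minus_def l_distr l_minus r_neg)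
  have ef: "e \<oplus> f = \<one>" using ec by (simp add: f_def a_minus_def a_lcomm[of e] r_neg)
  \<comment> \<open>The graded left ideal A_0 f + A_{>0}. It is proper because 1 = b f would give e
    = b f e = 0.\<close>
  define F where "F n = (if n = 0 then (\<lambda>b. b \<otimes> f) ` gpart A 0 else gpart A n)" for n :: nat
  have F: "graded_family F"
    unfolding graded_family_def
  proof (intro conjI allI ballI)
    fix n
    show "F n \<subseteq> gpart A n" using f0 gpart_mult_zero by (auto simp: F_def)
    show "\<zero> \<in> F n" using fc by (auto simp: F_def intro!: image_eqI[of _ _ \<zero>])
    fix y z assume yz: "y \<in> F n" "z \<in> F n"
    show "y \<oplus> z \<in> F n"
    proof (cases "n = 0")
      case True
      then obtain b c where "b \<in> gpart A 0" "c \<in> gpart A 0" "y = b \<otimes> f" "z = c \<otimes> f"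
        using yz by (auto simp: F_def)
      then show ?thesis using True fc gpart_carrier
        by (auto simp: F_def l_distr intro!: image_eqI[of _ _ "b \<oplus> c"])
    qed (use yz in \<open>auto simp: F_def\<close>)
  next
    fix i n b y assume b: "b \<in> gpart A i" and y: "y \<in> F n"
    show "b \<otimes> y \<in> F (i + n)"
    proof (cases "i = 0 \<and> n = 0")
      case True
      then obtain c where "c \<in> gpart A 0" "y = c \<otimes> f" using y by (auto simp: F_def)
      then show ?thesis using True fc gpart_carrier b
        by (auto simp: F_def m_assoc gpart_mult_zero intro!: image_eqI[of _ _ "b \<otimes> c"])
    next
      case False
      have "F n \<subseteq> gpart A n" using f0 gpart_mult_zero by (auto simp: F_def)
      then have "b \<otimes> y \<in> gpart A (i + n)" using b y by auto
      then show ?thesis using False by (auto simp: F_def)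
    qed
  qed
  have "\<one> \<notin> family_sum F"
  proof
    assume "\<one> \<in> family_sum F"
    then have "\<one> \<in> F 0" using family_sum_homog[OF F, of \<one> 0] by simp
    then obtain b where b: "b \<in> gpart A 0" "\<one> = b \<otimes> f" by (auto simp: F_def)
    have "e = (b \<otimes> f) \<otimes> e" using ec b(2) by (metis l_one)
    also have "\<dots> = \<zero>" using gpart_carrier[OF b(1)] fc ec fe by (simp add: m_assoc)
    finally show False using xe x0 xc by simp
  qed
  then obtain L where L: "maximal_graded_left_ideal A L" "family_sum F \<subseteq> L"
    using exists_maximal_graded_left_ideal[OF graded_left_ideal_family_sum[OF F]] by blast
  then have lid: "left_ideal A L" by (simp add: maximal_graded_left_ideal_def graded_left_ideal_def)
  have "f \<in> F 0" using fc by (auto simp: F_def intro!: image_eqI[of _ _ \<one>])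
  then have "f \<in> L" using family_sum_homog[OF F f0] L(2) by blast
  moreover have "e \<in> L"
    using x(1) L(1) left_idealD(4)[OF lid ac] a(2) by (auto simp: graded_Jacobson_def)
  ultimately have "\<one> \<in> L" using left_idealD(3)[OF lid, of e f] ef by simp
  then show False using L(1) left_ideal_eq_carrier[OF lid] by (simp add: maximal_graded_left_ideal_def)
qed

text \<open>The degree \<open>m\<close> part of J, which as a coset is the zero element of
  \<open>S\<close> in that degree.\<close>

definition S_zero :: "int \<Rightarrow> 'a set" where
  "S_zero m = (if m = 0 then {\<zero>} else zpart A m)"

lemma Jacobson_zpart:
  assumes ss: "semisimple_ring (A\<lparr>carrier := gpart A 0\<rparr>)"
  shows "graded_Jacobson A \<inter> zpart A m = S_zero m"
proof -
  have zero: "\<zero> \<in> graded_Jacobson A"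
    using positive_part_subset_Jacobson[of 1] gpart_zero[of 1] by auto
  consider "m = 0" | "m < 0" | "m > 0" by linarith
  then show ?thesis
  proof cases
    case 1
    have "graded_Jacobson A \<inter> gpart A 0 = {\<zero>}"
      using Jacobson_degree_zero[OF ss] zero gpart_zero by blast
    then show ?thesis using 1 by (simp add: S_zero_def zpart_def)
  next
    case 2
    then show ?thesis using zero by (simp add: S_zero_def zpart_def)
  next
    case 3
    then have "gpart A (nat m) \<subseteq> graded_Jacobson A" by (intro positive_part_subset_Jacobson) simp
    then show ?thesis using 3 by (simp add: S_zero_def zpart_def Int_absorb1)
  qed
qed

lemma zpart_minus: "x \<in> zpart A m \<Longrightarrow> \<ominus> x \<in> zpart A m"
  by (auto simp: zpart_def split: if_splits)

lemma zpart_translate: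
  assumes "x \<in> zpart A m"
  shows "(\<Union>h\<in>zpart A m. {h \<oplus> x}) = zpart A m"
proof -
  have "y \<in> (\<Union>h\<in>zpart A m. {h \<oplus> x})" if y: "y \<in> zpart A m" for y
  proof -
    have "y = (y \<oplus> \<ominus> x) \<oplus> x" using zpart_carrier[OF y] zpart_carrier[OF assms] by (simp add: a_assoc l_neg)
    then show ?thesis using zpart_add[OF y zpart_minus[OF assms]] by blast
  qed
  then show ?thesis using zpart_add[OF _ assms] by blast
qed

end

section \<open>Explicit description of the module \<open>S\<close>\<close>

locale semisimple_gr_alg = gr_alg +
  assumes semisimple: "semisimple_ring (A\<lparr>carrier := gpart A 0\<rparr>)"
begin

abbreviation "S \<equiv> S_mod A"

lemma S_zero_eq [simp]: "\<zero>\<^bsub>gcomp S m\<^esub> = S_zero m"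
  by (simp add: S_mod_def gquot_def Jacobson_zpart[OF semisimple])

lemma S_add: "C \<oplus>\<^bsub>gcomp S m\<^esub> D = (\<Union>c\<in>C. \<Union>d\<in>D. {c \<oplus> d})"
  by (simp add: S_mod_def gquot_def set_add_def set_mult_def left_part_def alg_bimod_def)

lemma S_act: "gact S i m a C = (\<Union>h\<in>S_zero (m + int i). \<Union>c\<in>C. {h \<oplus> a \<otimes> c})"
  by (simp add: S_mod_def gquot_def set_add_def set_mult_def left_part_def alg_bimod_def
      Jacobson_zpart[OF semisimple])

text \<open>J vanishes in degree 0, so cosets there are singletons. In every other degree J is the
  whole component of \<open>A\<close> and only the zero coset is left.\<close>

lemma S_el: "el S m = (if m = 0 then (\<lambda>a. {a}) ` gpart A 0 else {S_zero m})"
proof (cases "m = 0")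
  case True
  have "(\<lambda>x. \<Union>h\<in>S_zero 0. {h \<oplus> x}) ` gpart A 0 = (\<lambda>a. {a}) ` gpart A 0"
    by (intro image_cong) (simp_all add: S_zero_def gpart_carrier[of _ 0])
  then show ?thesis using True zpart_int[of 0]
    by (simp add: S_mod_def gquot_def Jacobson_zpart[OF semisimple] a_r_coset_def r_coset_def
        left_part_def alg_bimod_def)
next
  case False
  have "(\<lambda>x. \<Union>h\<in>S_zero m. {h \<oplus> x}) ` zpart A m = (\<lambda>x. S_zero m) ` zpart A m"
    using False by (intro image_cong) (simp_all add: S_zero_def zpart_translate)
  also have "\<dots> = {S_zero m}" using zpart_zero by blast
  finally show ?thesis using False
    by (simp add: S_mod_def gquot_def Jacobson_zpart[OF semisimple] a_r_coset_def r_coset_def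
        left_part_def alg_bimod_def)
qed

lemma S_zero_el [simp]: "S_zero m \<in> el S m"
  by (auto simp: S_el S_zero_def)

lemma S_zero_add_zero: "S_zero m \<oplus>\<^bsub>gcomp S m\<^esub> S_zero m = S_zero m"
proof (cases "m = 0")
  case False
  have "(\<Union>c\<in>zpart A m. \<Union>d\<in>zpart A m. {c \<oplus> d}) = (\<Union>d\<in>zpart A m. \<Union>c\<in>zpart A m. {c \<oplus> d})" by blast
  also have "\<dots> = (\<Union>d\<in>zpart A m. zpart A m)" by (rule SUP_cong[OF refl]) (rule zpart_translate)
  also have "\<dots> = zpart A m" using zpart_zero by blast
  finally show ?thesis using False by (simp add: S_add S_zero_def)
qed (simp add: S_add S_zero_def)

lemma S_act_trivial:
  assumes a: "a \<in> gpart A i" and C: "C \<subseteq> zpart A m" "C \<noteq> {}" and m: "m + int i \<noteq> 0"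
  shows "gact S i m a C = S_zero (m + int i)"
proof -
  have "gact S i m a C = (\<Union>c\<in>C. \<Union>h\<in>zpart A (m + int i). {h \<oplus> a \<otimes> c})"
    using m unfolding S_act S_zero_def by auto
  also have "\<dots> = (\<Union>c\<in>C. zpart A (m + int i))"
    by (rule SUP_cong[OF refl]) (rule zpart_translate[OF zpart_mult[OF a subsetD[OF C(1)]]])
  also have "\<dots> = zpart A (m + int i)" using C(2) by blast
  finally show ?thesis using m by (simp add: S_zero_def)
qed

lemma S_act_zero:
  assumes a: "a \<in> gpart A i"
  shows "gact S i m a (S_zero m) = S_zero (m + int i)"
proof (cases "m + int i = 0")
  case True
  then have "S_zero m = {\<zero>}" by (auto simp: S_zero_def zpart_def)
  then show ?thesis using True gpart_carrier[OF a] by (simp add: S_act S_zero_def)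
next
  case False
  have "\<zero> \<in> S_zero m" by (simp add: S_zero_def)
  then have "S_zero m \<noteq> {}" by blast
  then show ?thesis by (intro S_act_trivial[OF a _ _ False]) (simp_all add: S_zero_def)
qed

lemma S_act_pos:
  assumes a: "a \<in> gpart A i" "i > 0" and C: "C \<in> el S m"
  shows "gact S i m a C = S_zero (m + int i)"
proof (cases "m = 0")
  case True
  then show ?thesis using a C zpart_int[of 0] by (intro S_act_trivial) (auto simp: S_el)
next
  case False
  then show ?thesis using S_act_zero[OF a(1)] C by (simp add: S_el)
qed

lemma S_act_degree_zero:
  "a \<in> gpart A 0 \<Longrightarrow> b \<in> gpart A 0 \<Longrightarrow> gact S 0 0 a {b} = {a \<otimes> b}"
  using gpart_carrier[of a 0] gpart_carrier[of b 0] by (simp add: S_act S_zero_def)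

lemma stalk_el: "el (cob (stalk S) p) m = (if p = 0 then el S m else {S_zero m})"
  by (simp add: stalk_def gsub_def)

lemma stalk_add: "add (gcomp (cob (stalk S) p) m) = add (gcomp S m)"
  by (simp add: stalk_def gsub_def)

lemma stalk_act: "gact (cob (stalk S) p) = gact S"
  by (simp add: stalk_def gsub_def)

lemma stalk_diff: "C \<in> el (cob (stalk S) p) m \<Longrightarrow> cdiff (stalk S) p m C = S_zero m"
  by (simp add: stalk_def Let_def)

end

section \<open>Socle and torsion of an injective complex\<close>

text \<open>\<open>I\<close> stands for an injective resolution. The elements \<open>c0\<close> and
  \<open>c1\<close> serve to encode \<open>A\<close> into its carrier type, as
  \<open>inj_mod\<close> requires.\<close>

locale inj_cpx = semisimple_gr_alg K A for K :: "'k ring" and A :: "('k, 'a) gralg" (structure) +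
  fixes I :: "('a, ('a, 'x) res) cpx" and c0 c1 :: 'x
  assumes cpx: "gr_complex (gpart A) (graded_module A) I"
    and bdd: "bounded_below I"
    and inj_obs: "\<And>n. injective_obj (gpart A) (graded_module A) (cob I n)"
    and two_elems: "c0 \<noteq> c1"
    and noeth: "left_noetherian A"

sublocale inj_cpx \<subseteq> M: inj_mod K A "cob I n" c0 c1 for n
  using inj_obs two_elems by unfold_locales (auto simp: injective_obj_def)

context inj_cpx
begin

lemma d_hom: "cdiff I n j \<in> hom (add_monoid (gcomp (cob I n) j)) (add_monoid (gcomp (cob I (n + 1)) j))"
  using cpx by (auto simp: gr_complex_def ghom_def)

lemma d_closed [simp]: "x \<in> el (cob I n) j \<Longrightarrow> cdiff I n j x \<in> el (cob I (n + 1)) j"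
  using hom_in_carrier[OF d_hom] by simp

lemma d_add: "x \<in> el (cob I n) j \<Longrightarrow> y \<in> el (cob I n) j \<Longrightarrow>
    cdiff I n j (x \<oplus>\<^bsub>gcomp (cob I n) j\<^esub> y)
      = cdiff I n j x \<oplus>\<^bsub>gcomp (cob I (n + 1)) j\<^esub> cdiff I n j y"
  using hom_mult[OF d_hom] by simp

lemma d_act: "a \<in> gpart A i \<Longrightarrow> x \<in> el (cob I n) j \<Longrightarrow>
    cdiff I n (j + int i) (gact (cob I n) i j a x) = gact (cob I (n + 1)) i j a (cdiff I n j x)"
  using cpx by (auto simp: gr_complex_def ghom_def)

lemma dd [simp]: "x \<in> el (cob I n) j \<Longrightarrow>
    cdiff I (n + 1) j (cdiff I n j x) = \<zero>\<^bsub>gcomp (cob I (n + 2)) j\<^esub>"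
  using cpx by (auto simp: gr_complex_def)

lemma d_zero [simp]: "cdiff I n j \<zero>\<^bsub>gcomp (cob I n) j\<^esub> = \<zero>\<^bsub>gcomp (cob I (n + 1)) j\<^esub>"
  using d_add[of "\<zero>\<^bsub>gcomp (cob I n) j\<^esub>" n j "\<zero>\<^bsub>gcomp (cob I n) j\<^esub>"]
  by (simp add: M.G.add.l_cancel_one)

lemma d_neg:
  assumes "x \<in> el (cob I n) j"
  shows "cdiff I n j (\<ominus>\<^bsub>gcomp (cob I n) j\<^esub> x) = \<ominus>\<^bsub>gcomp (cob I (n + 1)) j\<^esub> cdiff I n j x"
  using assms d_add[of "\<ominus>\<^bsub>gcomp (cob I n) j\<^esub> x" n j x]
  by (intro M.G.minus_equality[symmetric]) (auto simp: M.G.l_neg)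

lemma d_minus: "x \<in> el (cob I n) j \<Longrightarrow> y \<in> el (cob I n) j \<Longrightarrow>
    cdiff I n j (x \<ominus>\<^bsub>gcomp (cob I n) j\<^esub> y)
      = cdiff I n j x \<ominus>\<^bsub>gcomp (cob I (n + 1)) j\<^esub> cdiff I n j y"
  by (simp add: a_minus_def d_add d_neg)

lemma d_pred_closed [simp]: "x \<in> el (cob I (n - 1)) j \<Longrightarrow> cdiff I (n - 1) j x \<in> el (cob I n) j"
  using d_closed[of x "n - 1" j] by simp

lemma d_pred_act: "a \<in> gpart A i \<Longrightarrow> x \<in> el (cob I (n - 1)) j \<Longrightarrow>
    cdiff I (n - 1) (j + int i) (gact (cob I (n - 1)) i j a x) = gact (cob I n) i j a (cdiff I (n - 1) j x)"
  using d_act[of a i x "n - 1" j] by simp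

lemma d_pred_add: "x \<in> el (cob I (n - 1)) j \<Longrightarrow> y \<in> el (cob I (n - 1)) j \<Longrightarrow>
    cdiff I (n - 1) j (x \<oplus>\<^bsub>gcomp (cob I (n - 1)) j\<^esub> y)
      = cdiff I (n - 1) j x \<oplus>\<^bsub>gcomp (cob I n) j\<^esub> cdiff I (n - 1) j y"
  using d_add[of x "n - 1" j y] by simp

lemma d_d_pred [simp]: "x \<in> el (cob I (n - 1)) j \<Longrightarrow>
    cdiff I n j (cdiff I (n - 1) j x) = \<zero>\<^bsub>gcomp (cob I (n + 1)) j\<^esub>"
  using dd[of x "n - 1" j] by (simp add: algebra_simps)

lemma d_pred_zero [simp]: "cdiff I (n - 1) j \<zero>\<^bsub>gcomp (cob I (n - 1)) j\<^esub> = \<zero>\<^bsub>gcomp (cob I n) j\<^esub>"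
  using d_zero[of "n - 1" j] by simp

lemma ann_d_pred:
  assumes "x \<in> el (cob I (n - 1)) j"
  shows "M.ann (n - 1) j x i \<subseteq> M.ann n j (cdiff I (n - 1) j x) i"
proof
  fix a assume a: "a \<in> M.ann (n - 1) j x i"
  show "a \<in> M.ann n j (cdiff I (n - 1) j x) i"
    using d_pred_act[OF M.annD(1)[OF a] assms] M.annD[OF a] by (intro M.annI) auto
qed

text \<open>These are the invariants of every correction: d d = 0 preserves the differential, and d
  w is killed by whatever kills w, so an annihilator can only grow.\<close>

lemma minus_d_pred:
  assumes "z \<in> el (cob I n) j" "w \<in> el (cob I (n - 1)) j"
    and "\<And>i. M.ann n j z i \<subseteq> M.ann (n - 1) j w i"
  defines "z' \<equiv> z \<ominus>\<^bsub>gcomp (cob I n) j\<^esub> cdiff I (n - 1) j w"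
  shows "z' \<in> el (cob I n) j" "cdiff I n j z' = cdiff I n j z" "M.ann n j z i \<subseteq> M.ann n j z' i"
proof -
  show "z' \<in> el (cob I n) j" using assms by simp
  show "cdiff I n j z' = cdiff I n j z"
    using assms(1,2) by (simp add: z'_def d_minus) (simp add: a_minus_def)
  show "M.ann n j z i \<subseteq> M.ann n j z' i"
    using M.ann_minus[OF assms(1) d_pred_closed[OF assms(2)]] assms(3)[of i] ann_d_pred[OF assms(2), of i]
    unfolding z'_def by blast
qed

text \<open>An element \<open>k z\<close> that is a coboundary \<open>d v\<close> is killed by subtracting \<open>d w\<close> from \<open>z\<close>, where \<open>w\<close>
  represents an extension to \<open>A\<close> of the map $x + a k \mapsto a v$ on $\mathrm{ann}(z) + A k$.\<close>

lemma kill_finite: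
  assumes z: "z \<in> el (cob I n) j" and H: "finite H" "\<And>e k. (e, k) \<in> H \<Longrightarrow> k \<in> gpart A e"
    and step: "\<And>e k z'. (e, k) \<in> H \<Longrightarrow> z' \<in> el (cob I n) j \<Longrightarrow> cdiff I n j z' = cdiff I n j z \<Longrightarrow>
      (\<And>i. M.ann n j z i \<subseteq> M.ann n j z' i) \<Longrightarrow>
      \<exists>v\<in>el (cob I (n - 1)) (j + int e). cdiff I (n - 1) (j + int e) v = gact (cob I n) e j k z' \<and>
        (\<forall>i. M.ann n (j + int e) (gact (cob I n) e j k z') i \<subseteq> M.ann (n - 1) (j + int e) v i)"
  shows "\<exists>w\<in>el (cob I (n - 1)) j. (\<forall>i. M.ann n j z i \<subseteq> M.ann (n - 1) j w i) \<and>
    (\<forall>e k. (e, k) \<in> H \<longrightarrow> k \<in> M.ann n j (z \<ominus>\<^bsub>gcomp (cob I n) j\<^esub> cdiff I (n - 1) j w) e)"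
  using H step
proof (induction H rule: finite_induct)
  case empty
  show ?case
    by (rule bexI[of _ "\<zero>\<^bsub>gcomp (cob I (n - 1)) j\<^esub>"]) (use M.annD(1) in auto)
next
  case (insert h H)
  obtain e k where h: "h = (e, k)" by (cases h)
  have k: "k \<in> gpart A e" using insert.prems(1)[of e k] h by simp
  obtain w where w: "w \<in> el (cob I (n - 1)) j" "\<And>i. M.ann n j z i \<subseteq> M.ann (n - 1) j w i"
    "\<And>e k. (e, k) \<in> H \<Longrightarrow> k \<in> M.ann n j (z \<ominus>\<^bsub>gcomp (cob I n) j\<^esub> cdiff I (n - 1) j w) e"
    using insert.IH insert.prems by (smt (verit) insertCI)
  define z' where "z' = z \<ominus>\<^bsub>gcomp (cob I n) j\<^esub> cdiff I (n - 1) j w"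
  note z' = minus_d_pred[OF z w(1,2), folded z'_def]
  \<comment> \<open>The preimage is taken for the element \<open>z'\<close> already corrected for
    \<open>H\<close>. This is why \<open>step\<close> is assumed for every \<open>z'\<close> with
    the differential of \<open>z\<close> and at least its annihilator.\<close>
  obtain v where v: "v \<in> el (cob I (n - 1)) (j + int e)"
    "cdiff I (n - 1) (j + int e) v = gact (cob I n) e j k z'"
    "\<And>i. M.ann n (j + int e) (gact (cob I n) e j k z') i \<subseteq> M.ann (n - 1) (j + int e) v i"
    using insert.prems(2)[of e k z'] h z' by auto
  \<comment> \<open>If a k kills z', then a kills k z' and hence v, which is the compatibility that
    \<open>extend\<close> asks for.\<close>
  have "a \<in> M.ann (n - 1) (j + int e) v i"
    if "a \<in> gpart A i" "a \<otimes> k \<in> M.ann n j z' (i + e)" for i a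
    using M.ann_act_iff[OF z'(1) k that(1)] that(2) v(3)[of i] by blast
  then obtain x where x: "x \<in> el (cob I (n - 1)) j" "\<And>i. M.ann n j z' i \<subseteq> M.ann (n - 1) j x i"
    "gact (cob I (n - 1)) e j k x = v"
    using M.extend[OF M.graded_family_ann[OF z'(1)] k v(1)] by blast
  note z'' = minus_d_pred[OF z'(1) x(1,2)]
  let ?w = "w \<oplus>\<^bsub>gcomp (cob I (n - 1)) j\<^esub> x"
  have eq: "z \<ominus>\<^bsub>gcomp (cob I n) j\<^esub> cdiff I (n - 1) j ?w = z' \<ominus>\<^bsub>gcomp (cob I n) j\<^esub> cdiff I (n - 1) j x"
    using z w(1) x(1) by (simp add: z'_def d_pred_add a_minus_def M.G.minus_add M.G.a_assoc)
  \<comment> \<open>k (z' - d x) = k z' - d (k x) = k z' - d v = 0. Generators killed earlier stay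
    killed because x is killed by ann z'.\<close>
  have "gact (cob I n) e j k (z' \<ominus>\<^bsub>gcomp (cob I n) j\<^esub> cdiff I (n - 1) j x) = \<zero>\<^bsub>gcomp (cob I n) (j + int e)\<^esub>"
    using k z'(1) x(1) d_pred_act[OF k x(1)] x(3) v(2)
    by (simp add: M.act_minus) (simp add: a_minus_def M.G.r_neg)
  then have "k \<in> M.ann n j (z' \<ominus>\<^bsub>gcomp (cob I n) j\<^esub> cdiff I (n - 1) j x) e"
    using k by (rule M.annI[rotated])
  moreover have "k' \<in> M.ann n j (z' \<ominus>\<^bsub>gcomp (cob I n) j\<^esub> cdiff I (n - 1) j x) e'" if "(e', k') \<in> H" for e' k'
    using w(3)[OF that] z''(3)[of e'] by (auto simp: z'_def)
  moreover have "M.ann n j z i \<subseteq> M.ann (n - 1) j ?w i" for i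
    using w(2)[of i] x(2)[of i] z'(3)[of i] M.ann_add[OF w(1) x(1)] by blast
  ultimately show ?case
    using w(1) x(1) h eq by (intro bexI[of _ ?w]) auto
qed

text \<open>Let e be the idempotent right identity of the degree 0 part of ann(d z). Passing to z -
  e z keeps the differential, as e kills d z, and a z = a e z for every a in that part. If all of
  A_i kills z, it also kills e z, because a e has the degree of a.\<close>

lemma degree_zero_adjust:
  assumes z: "z \<in> el (cob I (n - 1)) j"
  obtains z' where "z' \<in> el (cob I (n - 1)) j" "cdiff I (n - 1) j z' = cdiff I (n - 1) j z"
    "M.ann n j (cdiff I (n - 1) j z) 0 \<subseteq> M.ann (n - 1) j z' 0"
    "\<And>i. gpart A i \<subseteq> M.ann (n - 1) j z i \<Longrightarrow> gpart A i \<subseteq> M.ann (n - 1) j z' i"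
proof -
  let ?y = "cdiff I (n - 1) j z"
  let ?L = "M.ann n j ?y 0"
  have y: "?y \<in> el (cob I n) j" using z by simp
  have L: "graded_family (M.ann n j ?y)" by (rule M.graded_family_ann[OF y])
  obtain e where e: "e \<in> ?L" "\<And>x. x \<in> ?L \<Longrightarrow> x \<otimes> e = x"
  proof (rule semisimple_idempotent[OF semisimple, of ?L])
    show "a \<otimes> x \<in> ?L" if "a \<in> gpart A 0" "x \<in> ?L" for a x
      using M.ann_mult[OF y that] by simp
  qed (use L in \<open>auto simp: graded_family_def\<close>)
  have e0: "e \<in> gpart A 0" using M.annD(1)[OF e(1)] .
  let ?ez = "gact (cob I (n - 1)) 0 j e z"
  let ?z = "z \<ominus>\<^bsub>gcomp (cob I (n - 1)) j\<^esub> ?ez"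
  have ez: "?ez \<in> el (cob I (n - 1)) j" using M.act_closed[OF e0 z] by simp
  have act_ez: "gact (cob I (n - 1)) i j a ?ez = gact (cob I (n - 1)) i j (a \<otimes> e) z"
    if "a \<in> gpart A i" for a i
    using M.act_mult[OF that e0 z] by simp
  have "cdiff I (n - 1) j ?ez = gact (cob I n) 0 j e ?y"
    using d_pred_act[OF e0 z] by simp
  also have "\<dots> = \<zero>\<^bsub>gcomp (cob I n) j\<^esub>" using M.annD(2)[OF e(1)] by simp
  finally have dez: "cdiff I (n - 1) j ?ez = \<zero>\<^bsub>gcomp (cob I n) j\<^esub>" .
  show thesis
  proof
    show "?z \<in> el (cob I (n - 1)) j" using z ez by simp
    show "cdiff I (n - 1) j ?z = ?y"
      using d_minus[OF z ez] y dez by (simp add: a_minus_def)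
    show "?L \<subseteq> M.ann (n - 1) j ?z 0"
    proof
      fix a assume a: "a \<in> ?L"
      then have a0: "a \<in> gpart A 0" by (rule M.annD)
      have "gact (cob I (n - 1)) 0 j a ?z = \<zero>\<^bsub>gcomp (cob I (n - 1)) (j + int 0)\<^esub>"
        using M.act_minus[OF a0 z ez] act_ez[OF a0] e(2)[OF a] M.act_closed[OF a0 z]
        by (simp add: a_minus_def M.G.r_neg)
      then show "a \<in> M.ann (n - 1) j ?z 0" using a0 by (intro M.annI)
    qed
    fix i assume i: "gpart A i \<subseteq> M.ann (n - 1) j z i"
    show "gpart A i \<subseteq> M.ann (n - 1) j ?z i"
    proof
      fix a assume a: "a \<in> gpart A i"
      have "a \<otimes> e \<in> gpart A i" using gpart_mult[OF a e0] by simp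
      then have "a \<in> M.ann (n - 1) j ?ez i" using i a act_ez[OF a] by (auto simp: M.ann_def)
      then show "a \<in> M.ann (n - 1) j ?z i" using M.ann_minus[OF z ez] a i by blast
    qed
  qed
qed

abbreviation tors :: "int \<Rightarrow> int \<Rightarrow> ('a, 'x) res set" where
  "tors n j \<equiv> torsion (gpart A) (cob I n) j"

definition socle :: "int \<Rightarrow> int \<Rightarrow> ('a, 'x) res set" where
  "socle n j = {x \<in> el (cob I n) j. \<forall>i>0. gpart A i \<subseteq> M.ann n j x i}"

lemma tors_el: "x \<in> tors n j \<Longrightarrow> x \<in> el (cob I n) j"
  by (simp add: torsion_def)

lemma socle_tors: "x \<in> socle n j \<Longrightarrow> x \<in> tors n j"
  unfolding M.torsion_iff_ann socle_def by (metis (no_types, lifting) less_one linorder_not_less mem_Collect_eq order_less_le_trans zero_less_one)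

lemma tors_mono:
  assumes "x \<in> tors n j" "y \<in> el (cob I m) j'" "\<And>i. M.ann n j x i \<subseteq> M.ann m j' y i"
  shows "y \<in> tors m j'"
  using assms unfolding M.torsion_iff_ann by blast

lemma tors_act:
  assumes x: "x \<in> tors n j" and k: "k \<in> gpart A e"
  shows "gact (cob I n) e j k x \<in> tors n (j + int e)"
proof -
  have xe: "x \<in> el (cob I n) j" using x by (rule tors_el)
  obtain s where s: "\<And>i. i \<ge> s \<Longrightarrow> gpart A i \<subseteq> M.ann n j x i"
    using x unfolding M.torsion_iff_ann by blast
  have "gpart A i \<subseteq> M.ann n (j + int e) (gact (cob I n) e j k x) i" if "i \<ge> s" for i
    using M.ann_act_iff[OF xe k] s[of "i + e"] gpart_mult[OF _ k] that by (meson subset_iff trans_le_add1)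
  then show ?thesis using xe k unfolding M.torsion_iff_ann by auto
qed

lemma tors_add:
  assumes "x \<in> tors n j" "y \<in> tors n j"
  shows "x \<oplus>\<^bsub>gcomp (cob I n) j\<^esub> y \<in> tors n j"
proof -
  from assms obtain s t where "\<forall>i\<ge>s. gpart A i \<subseteq> M.ann n j x i" "\<forall>i\<ge>t. gpart A i \<subseteq> M.ann n j y i"
    unfolding M.torsion_iff_ann by blast
  then have "\<forall>i\<ge>max s t. gpart A i \<subseteq> M.ann n j (x \<oplus>\<^bsub>gcomp (cob I n) j\<^esub> y) i"
    using M.ann_add[OF tors_el[OF assms(1)] tors_el[OF assms(2)]]
    by (meson max.boundedE subset_iff)
  then show ?thesis
    using assms tors_el unfolding M.torsion_iff_ann by blast
qed

lemma zero_tors: "\<zero>\<^bsub>gcomp (cob I n) j\<^esub> \<in> tors n j"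
  unfolding M.torsion_iff_ann by simp

section \<open>Exactness of the torsion and socle complexes from a total degree on\<close>

definition exact_at :: "(int \<Rightarrow> int \<Rightarrow> ('a, 'x) res set) \<Rightarrow> int \<Rightarrow> int \<Rightarrow> bool" where
  "exact_at T n j \<longleftrightarrow> (\<forall>y\<in>T n j. cdiff I n j y = \<zero>\<^bsub>gcomp (cob I (n + 1)) j\<^esub> \<longrightarrow>
     (\<exists>z\<in>T (n - 1) j. cdiff I (n - 1) j z = y))"

definition exact_from :: "int \<Rightarrow> (int \<Rightarrow> int \<Rightarrow> ('a, 'x) res set) \<Rightarrow> bool" where
  "exact_from q T \<longleftrightarrow> (\<forall>n j. n + j \<ge> q \<longrightarrow> exact_at T n j)"

text \<open>Induction on \<open>n\<close>. After an adjustment by an idempotent of \<open>A\<^sub>0\<close>, only generators of positive degree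
  \<open>e\<close> of \<open>ann y\<close> remain to be killed, and passing from \<open>(n + 1, j)\<close> to \<open>(n, j + e)\<close> does not decrease the
  total degree.\<close>

lemma tors_lift_ann:
  assumes ex: "exact_from q tors"
  shows "n + j \<ge> q \<Longrightarrow> y \<in> tors n j \<Longrightarrow> cdiff I n j y = \<zero>\<^bsub>gcomp (cob I (n + 1)) j\<^esub> \<Longrightarrow>
    \<exists>z\<in>tors (n - 1) j. cdiff I (n - 1) j z = y \<and> (\<forall>i. M.ann n j y i \<subseteq> M.ann (n - 1) j z i)"
proof -
  obtain n0 where n0: "\<And>i j. i < n0 \<Longrightarrow> el (cob I i) j = {\<zero>\<^bsub>gcomp (cob I i) j\<^esub>}"
    using bdd by (auto simp: bounded_below_def)
  let ?P = "\<lambda>n. \<forall>j y. n + j \<ge> q \<longrightarrow> y \<in> tors n j \<longrightarrow> cdiff I n j y = \<zero>\<^bsub>gcomp (cob I (n + 1)) j\<^esub> \<longrightarrow>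
    (\<exists>z\<in>tors (n - 1) j. cdiff I (n - 1) j z = y \<and> (\<forall>i. M.ann n j y i \<subseteq> M.ann (n - 1) j z i))"
  have low: "?P n" if "n < n0" for n
  proof (intro allI impI)
    fix j y assume "y \<in> tors n j"
    then have "y = \<zero>\<^bsub>gcomp (cob I n) j\<^esub>" using tors_el n0[OF that] by blast
    then show "\<exists>z\<in>tors (n - 1) j. cdiff I (n - 1) j z = y \<and> (\<forall>i. M.ann n j y i \<subseteq> M.ann (n - 1) j z i)"
      by (intro bexI[OF _ zero_tors]) auto
  qed
  \<comment> \<open>The induction starts one place below \<open>n0\<close>, where the complex still
    vanishes and \<open>low\<close> applies.\<close>
  have "?P n" if "n \<ge> n0 - 1" for n
    using that
  proof (induction n rule: int_ge_induct)
    case base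
    then show ?case using low[of "n0 - 1"] by simp
  next
    case (step n)
    show ?case
    proof (intro allI impI)
      fix j y assume nj: "n + 1 + j \<ge> q" and y: "y \<in> tors (n + 1) j"
        and dy: "cdiff I (n + 1) j y = \<zero>\<^bsub>gcomp (cob I (n + 1 + 1)) j\<^esub>"
      \<comment> \<open>Exactness alone gives a preimage without control of its annihilator. The
        degree 0 part of ann y is imposed next, and the generators \<open>H\<close> of ann y after
        that.\<close>
      obtain z0 where z0: "z0 \<in> tors n j" "cdiff I n j z0 = y"
        using ex nj y dy unfolding exact_from_def exact_at_def by force
      obtain z where z: "z \<in> el (cob I n) j" "cdiff I n j z = y" "M.ann (n + 1) j y 0 \<subseteq> M.ann n j z 0"
        "\<And>i. gpart A i \<subseteq> M.ann n j z0 i \<Longrightarrow> gpart A i \<subseteq> M.ann n j z i"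
        using degree_zero_adjust[of z0 "n + 1" j] tors_el[OF z0(1)] z0(2) by auto
      have z_tors: "z \<in> tors n j" using z(1,4) z0(1) unfolding M.torsion_iff_ann by blast
      have L: "graded_family (M.ann (n + 1) j y)" by (rule M.graded_family_ann[OF tors_el[OF y]])
      obtain H where H: "finite H" "\<And>i k. (i, k) \<in> H \<Longrightarrow> k \<in> M.ann (n + 1) j y i"
        "\<And>L' i. graded_family L' \<Longrightarrow> (\<And>i k. (i, k) \<in> H \<Longrightarrow> k \<in> L' i) \<Longrightarrow> M.ann (n + 1) j y i \<subseteq> L' i"
        using graded_family_generators[OF noeth L] by metis
      have "\<exists>w\<in>el (cob I (n - 1)) j. (\<forall>i. M.ann n j z i \<subseteq> M.ann (n - 1) j w i) \<and>
          (\<forall>e k. (e, k) \<in> H \<longrightarrow> k \<in> M.ann n j (z \<ominus>\<^bsub>gcomp (cob I n) j\<^esub> cdiff I (n - 1) j w) e)"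
      proof (rule kill_finite[OF z(1) H(1)])
        show "k \<in> gpart A e" if "(e, k) \<in> H" for e k using H(2)[OF that] by (rule M.annD)
        fix e k z' assume ek: "(e, k) \<in> H" and z': "z' \<in> el (cob I n) j" "cdiff I n j z' = cdiff I n j z"
          "\<And>i. M.ann n j z i \<subseteq> M.ann n j z' i"
        have k: "k \<in> gpart A e" using H(2)[OF ek] by (rule M.annD)
        let ?u = "gact (cob I n) e j k z'"
        show "\<exists>v\<in>el (cob I (n - 1)) (j + int e). cdiff I (n - 1) (j + int e) v = ?u \<and>
          (\<forall>i. M.ann n (j + int e) ?u i \<subseteq> M.ann (n - 1) (j + int e) v i)"
        proof (cases "e = 0")
          case True
          \<comment> \<open>Generators of degree 0 already kill z' by the adjustment, so the
            preimage 0 serves.\<close>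
          then have "k \<in> M.ann n j z' e" using H(2)[OF ek] z(3) z'(3) by blast
          then have "?u = \<zero>\<^bsub>gcomp (cob I n) (j + int e)\<^esub>" by (rule M.annD)
          then show ?thesis by (intro bexI[of _ "\<zero>\<^bsub>gcomp (cob I (n - 1)) (j + int e)\<^esub>"]) auto
        next
          case False
          \<comment> \<open>k z' is torsion like z', and d (k z') = k y = 0, so the induction
            hypothesis applies to it.\<close>
          have "?u \<in> tors n (j + int e)" using tors_act[OF tors_mono[OF z_tors z'(1,3)] k] .
          moreover have "cdiff I n (j + int e) ?u = \<zero>\<^bsub>gcomp (cob I (n + 1)) (j + int e)\<^esub>"
            using d_act[OF k z'(1)] z'(2) z(2) M.annD(2)[OF H(2)[OF ek]] by simp
          moreover have "n + (j + int e) \<ge> q" using nj False by simp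
          ultimately obtain v where "v \<in> tors (n - 1) (j + int e)" "cdiff I (n - 1) (j + int e) v = ?u"
            "\<forall>i. M.ann n (j + int e) ?u i \<subseteq> M.ann (n - 1) (j + int e) v i"
            using step.IH by blast
          then show ?thesis using tors_el by blast
        qed
      qed
      then obtain w where w: "w \<in> el (cob I (n - 1)) j" "\<And>i. M.ann n j z i \<subseteq> M.ann (n - 1) j w i"
        "\<And>e k. (e, k) \<in> H \<Longrightarrow> k \<in> M.ann n j (z \<ominus>\<^bsub>gcomp (cob I n) j\<^esub> cdiff I (n - 1) j w) e"
        by blast
      let ?z = "z \<ominus>\<^bsub>gcomp (cob I n) j\<^esub> cdiff I (n - 1) j w"
      note z' = minus_d_pred[OF z(1) w(1,2)]
      \<comment> \<open>The annihilator of the corrected element is a graded family containing the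
        generators \<open>H\<close> of ann y.\<close>
      have "M.ann (n + 1) j y i \<subseteq> M.ann n j ?z i" for i
        by (rule H(3)[OF M.graded_family_ann[OF z'(1)] w(3)])
      moreover have "?z \<in> tors n j" using tors_mono[OF z_tors z'(1,3)] .
      ultimately show "\<exists>z\<in>tors (n + 1 - 1) j. cdiff I (n + 1 - 1) j z = y \<and>
          (\<forall>i. M.ann (n + 1) j y i \<subseteq> M.ann (n + 1 - 1) j z i)"
        using z'(2) z(2) by auto
    qed
  qed
  then have "?P n" for n using low[of n] by (cases "n < n0") auto
  then show "n + j \<ge> q \<Longrightarrow> y \<in> tors n j \<Longrightarrow> cdiff I n j y = \<zero>\<^bsub>gcomp (cob I (n + 1)) j\<^esub> \<Longrightarrow>
    \<exists>z\<in>tors (n - 1) j. cdiff I (n - 1) j z = y \<and> (\<forall>i. M.ann n j y i \<subseteq> M.ann (n - 1) j z i)"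
    by blast
qed

text \<open>A preimage killed by ann y inherits the annihilation by positive degrees, so it lies in
  the socle when y does.\<close>

lemma socle_exact:
  assumes "exact_from q tors"
  shows "exact_from q socle"
  unfolding exact_from_def exact_at_def
proof (intro allI impI ballI)
  fix n j y assume "n + j \<ge> q" "y \<in> socle n j" "cdiff I n j y = \<zero>\<^bsub>gcomp (cob I (n + 1)) j\<^esub>"
  then obtain z where z: "z \<in> tors (n - 1) j" "cdiff I (n - 1) j z = y"
    "\<forall>i. M.ann n j y i \<subseteq> M.ann (n - 1) j z i"
    using tors_lift_ann[OF assms] socle_tors by blast
  then have "z \<in> socle (n - 1) j"
    using \<open>y \<in> socle n j\<close> tors_el[OF z(1)] unfolding socle_def by blast
  then show "\<exists>z\<in>socle (n - 1) j. cdiff I (n - 1) j z = y" using z(2) by blast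
qed

text \<open>The converse: an element killed by \<open>A\<close> in degrees above \<open>s\<close> has all its multiples of degree
  \<open>s\<close> in the socle, so these can be killed by the hypothesis, and \<open>s\<close> decreases.\<close>

lemma tors_exact:
  assumes ex: "exact_from q socle"
  shows "exact_from q tors"
proof -
  \<comment> \<open>The induction parameter \<open>s\<close> is a bound from which on all of A_i
    kills y. Torsion elements are those having such a bound.\<close>
  have *: "\<exists>z\<in>tors (n - 1) j. cdiff I (n - 1) j z = y"
    if nj: "n + j \<ge> q" and "y \<in> el (cob I n) j" "cdiff I n j y = \<zero>\<^bsub>gcomp (cob I (n + 1)) j\<^esub>"
      "\<And>i. i \<ge> s \<Longrightarrow> gpart A i \<subseteq> M.ann n j y i" for s n j y
    using that(2-)
  proof (induction s arbitrary: y)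
    case 0
    \<comment> \<open>With bound 0 the element is killed by 1.\<close>
    then have "y = \<zero>\<^bsub>gcomp (cob I n) j\<^esub>"
      using M.annD(2)[of \<one> n j y 0] gpart_one by force
    then show ?case using zero_tors by (intro bexI[OF _ zero_tors]) auto
  next
    case (Suc s)
    note y = Suc.prems
    show ?case
    proof (cases "s = 0")
      case True
      then have "y \<in> socle n j" using y by (auto simp: socle_def)
      then show ?thesis using ex nj y(2) socle_tors unfolding exact_from_def exact_at_def by blast
    next
      case False
      \<comment> \<open>The left ideal of all elements of degree at least \<open>s\<close>. Once its
        generators kill the corrected y, the bound has dropped from s + 1 to s.\<close>
      define L where "L i = (if s \<le> i then gpart A i else {\<zero>})" for i
      have L: "graded_family L" unfolding graded_family_def L_def
        using gpart_carrier by (auto simp: trans_le_add2)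
      obtain H where H: "finite H" "\<And>i k. (i, k) \<in> H \<Longrightarrow> k \<in> L i"
        "\<And>L' i. graded_family L' \<Longrightarrow> (\<And>i k. (i, k) \<in> H \<Longrightarrow> k \<in> L' i) \<Longrightarrow> L i \<subseteq> L' i"
        using graded_family_generators[OF noeth L] by metis
      have Hk: "k \<in> gpart A e" if "(e, k) \<in> H" for e k
        using H(2)[OF that] by (auto simp: L_def split: if_splits)
      have "\<exists>w\<in>el (cob I (n - 1)) j. (\<forall>i. M.ann n j y i \<subseteq> M.ann (n - 1) j w i) \<and>
          (\<forall>e k. (e, k) \<in> H \<longrightarrow> k \<in> M.ann n j (y \<ominus>\<^bsub>gcomp (cob I n) j\<^esub> cdiff I (n - 1) j w) e)"
      proof (rule kill_finite[OF y(1) H(1) Hk])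
        fix e k z' assume ek: "(e, k) \<in> H" and z': "z' \<in> el (cob I n) j" "cdiff I n j z' = cdiff I n j y"
          "\<And>i. M.ann n j y i \<subseteq> M.ann n j z' i"
        have k: "k \<in> gpart A e" by (rule Hk[OF ek])
        let ?u = "gact (cob I n) e j k z'"
        show "\<exists>v\<in>el (cob I (n - 1)) (j + int e). cdiff I (n - 1) (j + int e) v = ?u \<and>
          (\<forall>i. M.ann n (j + int e) ?u i \<subseteq> M.ann (n - 1) (j + int e) v i)"
        proof (cases "s \<le> e")
          case False
          then have "k = \<zero>" using H(2)[OF ek] by (simp add: L_def)
          then have "?u = \<zero>\<^bsub>gcomp (cob I n) (j + int e)\<^esub>" using z'(1) by simp
          then show ?thesis by (intro bexI[of _ "\<zero>\<^bsub>gcomp (cob I (n - 1)) (j + int e)\<^esub>"]) auto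
        next
          case True
          \<comment> \<open>For a of positive degree, a k has degree at least s + 1, so it kills y
            and with it z'.\<close>
          have "gpart A i \<subseteq> M.ann n (j + int e) ?u i" if "i > 0" for i
          proof
            fix a assume a: "a \<in> gpart A i"
            have "gpart A (i + e) \<subseteq> M.ann n j y (i + e)" using y(3) True that by simp
            then have "a \<otimes> k \<in> M.ann n j z' (i + e)" using gpart_mult[OF a k] z'(3) by blast
            then show "a \<in> M.ann n (j + int e) ?u i" using M.ann_act_iff[OF z'(1) k a] by blast
          qed
          then have u: "?u \<in> socle n (j + int e)" using z'(1) k by (simp add: socle_def)
          moreover have "cdiff I n (j + int e) ?u = \<zero>\<^bsub>gcomp (cob I (n + 1)) (j + int e)\<^esub>"
            using d_act[OF k z'(1)] z'(2) y(2) k by simp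
          moreover have "n + (j + int e) \<ge> q" using nj by simp
          ultimately obtain v0 where v0: "v0 \<in> socle (n - 1) (j + int e)" "cdiff I (n - 1) (j + int e) v0 = ?u"
            using ex unfolding exact_from_def exact_at_def by blast
          have v0e: "v0 \<in> el (cob I (n - 1)) (j + int e)" using v0(1) by (simp add: socle_def)
          \<comment> \<open>The socle preimage is killed by all positive degrees. The adjustment
            keeps this and adds the degree 0 part, so v is killed by the whole annihilator of k
            z'.\<close>
          obtain v where v: "v \<in> el (cob I (n - 1)) (j + int e)" "cdiff I (n - 1) (j + int e) v = ?u"
            "M.ann n (j + int e) ?u 0 \<subseteq> M.ann (n - 1) (j + int e) v 0"
            "\<And>i. gpart A i \<subseteq> M.ann (n - 1) (j + int e) v0 i \<Longrightarrow> gpart A i \<subseteq> M.ann (n - 1) (j + int e) v i"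
            using degree_zero_adjust[OF v0e] v0(2) by auto
          have "M.ann n (j + int e) ?u i \<subseteq> M.ann (n - 1) (j + int e) v i" for i
          proof (cases "i = 0")
            case False
            then have "gpart A i \<subseteq> M.ann (n - 1) (j + int e) v i"
              using v(4) v0(1) by (simp add: socle_def)
            then show ?thesis using M.annD(1) by blast
          qed (use v(3) in simp)
          then show ?thesis using v(1,2) by blast
        qed
      qed
      then obtain w where w: "w \<in> el (cob I (n - 1)) j" "\<And>i. M.ann n j y i \<subseteq> M.ann (n - 1) j w i"
        "\<And>e k. (e, k) \<in> H \<Longrightarrow> k \<in> M.ann n j (y \<ominus>\<^bsub>gcomp (cob I n) j\<^esub> cdiff I (n - 1) j w) e"
        by blast
      let ?y = "y \<ominus>\<^bsub>gcomp (cob I n) j\<^esub> cdiff I (n - 1) j w"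
      note y' = minus_d_pred[OF y(1) w(1,2)]
      \<comment> \<open>The correction inherits torsion from y through ann y, so that y = (y - d w)
        + d w is the coboundary of a torsion element.\<close>
      have w_tors: "w \<in> tors (n - 1) j"
        using w(1,2) y(3) unfolding M.torsion_iff_ann by blast
      have "L i \<subseteq> M.ann n j ?y i" for i
        by (rule H(3)[OF M.graded_family_ann[OF y'(1)] w(3)])
      then have ann_y': "gpart A i \<subseteq> M.ann n j ?y i" if "i \<ge> s" for i
        using that by (metis L_def)
      have "\<exists>z\<in>tors (n - 1) j. cdiff I (n - 1) j z = ?y"
        by (rule Suc.IH[OF y'(1) _ ann_y']) (simp_all only: y'(2) y(2))
      then obtain z where z: "z \<in> tors (n - 1) j" "cdiff I (n - 1) j z = ?y" ..
      have "cdiff I (n - 1) j (z \<oplus>\<^bsub>gcomp (cob I (n - 1)) j\<^esub> w) = y"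
        using d_pred_add[OF tors_el[OF z(1)] w(1)] z(2) y(1) d_pred_closed[OF w(1)]
        by (simp add: a_minus_def M.G.a_assoc M.G.l_neg)
      then show ?thesis using tors_add[OF z(1) w_tors] by blast
    qed
  qed
  show ?thesis unfolding exact_from_def exact_at_def
  proof (intro allI impI ballI)
    fix n j y assume nj: "n + j \<ge> q" and y: "y \<in> tors n j" "cdiff I n j y = \<zero>\<^bsub>gcomp (cob I (n + 1)) j\<^esub>"
    obtain s where "\<And>i. i \<ge> s \<Longrightarrow> gpart A i \<subseteq> M.ann n j y i"
      using y(1) unfolding M.torsion_iff_ann by blast
    then show "\<exists>z\<in>tors (n - 1) j. cdiff I (n - 1) j z = y"
      using *[OF nj tors_el[OF y(1)] y(2)] by blast
  qed
qed

end

section \<open>Cohomology and regularity\<close>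

lemma (in abelian_group) translate_eq_iff:
  assumes B: "B \<subseteq> carrier G" "\<zero> \<in> B" "\<And>b c. b \<in> B \<Longrightarrow> c \<in> B \<Longrightarrow> b \<oplus> c \<in> B"
      "\<And>b. b \<in> B \<Longrightarrow> \<ominus> b \<in> B"
    and x: "x \<in> carrier G"
  shows "(\<lambda>b. b \<oplus> x) ` B = B \<longleftrightarrow> x \<in> B"
proof
  assume "(\<lambda>b. b \<oplus> x) ` B = B"
  then have "\<zero> \<oplus> x \<in> B" using B(2) by blast
  then show "x \<in> B" using x by simp
next
  assume xB: "x \<in> B"
  have "c \<in> (\<lambda>b. b \<oplus> x) ` B" if c: "c \<in> B" for c
  proof -
    have "c = (c \<oplus> \<ominus> x) \<oplus> x" using c x B(1) by (simp add: subset_iff a_assoc l_neg)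
    then show ?thesis using B(3)[OF c B(4)[OF xB]] by blast
  qed
  then show "(\<lambda>b. b \<oplus> x) ` B = B" using B(3) xB by blast
qed

text \<open>Elements of \<open>cohom\<close> are cosets, so triviality is an equality of translated
  sets. No group law enters, and the same criterion serves both the torsion complex and the Hom
  complex.\<close>

lemma cohom_trivial_iff:
  fixes X :: "('o, 'm) cpx"
  assumes "cocycles X i j \<noteq> {}"
  shows "el (cohom X i) j = {\<zero>\<^bsub>gcomp (cohom X i) j\<^esub>} \<longleftrightarrow>
    (\<forall>x\<in>cocycles X i j.
       (\<lambda>b. b \<oplus>\<^bsub>gcomp (cob X i) j\<^esub> x) ` coboundaries X i j = coboundaries X i j)"
proof -
  have "el (cohom X i) j = (\<lambda>x. (\<lambda>b. b \<oplus>\<^bsub>gcomp (cob X i) j\<^esub> x) ` coboundaries X i j) ` cocycles X i j"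
    by (simp add: cohom_def gquot_def gsub_def a_r_coset_def r_coset_def UNION_singleton_eq_range)
  moreover have "\<zero>\<^bsub>gcomp (cohom X i) j\<^esub> = coboundaries X i j"
    by (simp add: cohom_def gquot_def)
  moreover have "f ` Z = {c} \<longleftrightarrow> (\<forall>x\<in>Z. f x = c)" if "Z \<noteq> {}" for f :: "'m \<Rightarrow> 'm set" and Z c
    using that by blast
  ultimately show ?thesis using assms by simp
qed

text \<open>With q = i + j, the contrapositive of the assumption turns a nonzero class of X in total
  degree q into one of Y in total degree at least q. Infinite suprema are covered as well.\<close>

lemma sup_deg_le:
  assumes "\<And>q. (\<And>i j. i + j \<ge> q \<Longrightarrow> el (cohom Y i) j = {\<zero>\<^bsub>gcomp (cohom Y i) j\<^esub>}) \<Longrightarrow>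
    (\<And>i j. i + j \<ge> q \<Longrightarrow> el (cohom X i) j = {\<zero>\<^bsub>gcomp (cohom X i) j\<^esub>})"
  shows "sup_deg X \<le> sup_deg Y"
  unfolding sup_deg_def[of X]
proof (rule Sup_least)
  fix r assume "r \<in> {ereal (real_of_int (i + j)) |i j. el (cohom X i) j \<noteq> {\<zero>\<^bsub>gcomp (cohom X i) j\<^esub>}}"
  then obtain i j where r: "r = ereal (real_of_int (i + j))" "el (cohom X i) j \<noteq> {\<zero>\<^bsub>gcomp (cohom X i) j\<^esub>}"
    by blast
  then obtain i' j' where ij': "i' + j' \<ge> i + j" "el (cohom Y i') j' \<noteq> {\<zero>\<^bsub>gcomp (cohom Y i') j'\<^esub>}"
    using assms[of "i + j" i j] by blast
  have "r \<le> ereal (real_of_int (i' + j'))" unfolding r(1) ereal_less_eq of_int_le_iff by (rule ij'(1))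
  also have "\<dots> \<le> sup_deg Y" unfolding sup_deg_def using ij'(2) by (intro Sup_upper) blast
  finally show "r \<le> sup_deg Y" .
qed

text \<open>Over a one-element type all nonempty sets coincide, so every cohomology group is
  trivial. This is how X being nonzero supplies the two values that encode \<open>A\<close>.\<close>

lemma two_elements_if_not_acyclic:
  fixes X :: "('a, 'x) cpx"
  assumes X: "gr_complex G (graded_module A) X" and "\<not> acyclic_cpx X"
  obtains c0 c1 :: 'x where "c0 \<noteq> c1"
proof (rule ccontr)
  assume "\<not> thesis"
  then have eq: "a = b" for a b :: 'x using that by blast
  have set_eq: "s = t" if ne: "s \<noteq> {}" "t \<noteq> {}" for s t :: "'x set"
  proof -
    obtain a b where "a \<in> s" "b \<in> t" using ne by blast
    then have "x \<in> s" "x \<in> t" for x using eq[of x a] eq[of x b] by simp_all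
    then show ?thesis by blast
  qed
  have zero: "\<zero>\<^bsub>gcomp (cob X i) j\<^esub> \<in> el (cob X i) j" for i j
    using X by (auto simp: gr_complex_def graded_module_def intro!: abelian_groupE(2))
  have "el (cohom X i) j = {\<zero>\<^bsub>gcomp (cohom X i) j\<^esub>}" for i j
  proof -
    have B: "coboundaries X i j \<noteq> {}" using zero by (auto simp: coboundaries_def)
    have "cocycles X i j \<noteq> {}" using zero eq unfolding cocycles_def by blast
    moreover have "(\<lambda>b. b \<oplus>\<^bsub>gcomp (cob X i) j\<^esub> x) ` coboundaries X i j = coboundaries X i j" for x
      using B by (intro set_eq) simp_all
    ultimately show ?thesis using cohom_trivial_iff[of X i j] by simp
  qed
  then show False using assms(2) by (auto simp: acyclic_cpx_def)
qed

section \<open>Vanishing cohomology as exactness, and \<open>Hom\<close> from \<open>S\<close> as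
  the socle\<close>

context inj_cpx
begin

definition subgroups :: "(int \<Rightarrow> int \<Rightarrow> ('a, 'x) res set) \<Rightarrow> bool" where
  "subgroups T \<longleftrightarrow> (\<forall>n j. T n j \<subseteq> el (cob I n) j \<and> \<zero>\<^bsub>gcomp (cob I n) j\<^esub> \<in> T n j \<and>
     (\<forall>x\<in>T n j. \<ominus>\<^bsub>gcomp (cob I n) j\<^esub> x \<in> T n j \<and>
        (\<forall>y\<in>T n j. x \<oplus>\<^bsub>gcomp (cob I n) j\<^esub> y \<in> T n j)))"

text \<open>The coboundaries of a family of subgroups form a subgroup, and a translate of a subgroup
  is that subgroup exactly when the translating element belongs to it.\<close>

lemma exact_at_iff_translate:
  assumes T: "subgroups T"
  shows "exact_at T n j \<longleftrightarrow> (\<forall>x\<in>T n j. cdiff I n j x = \<zero>\<^bsub>gcomp (cob I (n + 1)) j\<^esub> \<longrightarrow>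
    (\<lambda>b. b \<oplus>\<^bsub>gcomp (cob I n) j\<^esub> x) ` cdiff I (n - 1) j ` T (n - 1) j = cdiff I (n - 1) j ` T (n - 1) j)"
proof -
  let ?B = "cdiff I (n - 1) j ` T (n - 1) j"
  have Te: "\<And>x n. x \<in> T n j \<Longrightarrow> x \<in> el (cob I n) j" and T0: "\<zero>\<^bsub>gcomp (cob I (n - 1)) j\<^esub> \<in> T (n - 1) j"
    and Tneg: "\<And>x. x \<in> T (n - 1) j \<Longrightarrow> \<ominus>\<^bsub>gcomp (cob I (n - 1)) j\<^esub> x \<in> T (n - 1) j"
    and Tadd: "\<And>x y. x \<in> T (n - 1) j \<Longrightarrow> y \<in> T (n - 1) j \<Longrightarrow> x \<oplus>\<^bsub>gcomp (cob I (n - 1)) j\<^esub> y \<in> T (n - 1) j"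
    using T by (simp_all add: subgroups_def subset_iff)
  have translate: "(\<lambda>b. b \<oplus>\<^bsub>gcomp (cob I n) j\<^esub> x) ` ?B = ?B \<longleftrightarrow> x \<in> ?B" if x: "x \<in> T n j" for x
  proof (rule M.G.translate_eq_iff)
    show "?B \<subseteq> el (cob I n) j" using Te d_pred_closed by blast
    show "\<zero>\<^bsub>gcomp (cob I n) j\<^esub> \<in> ?B" using T0 d_pred_zero by (metis image_eqI)
    show "b \<oplus>\<^bsub>gcomp (cob I n) j\<^esub> c \<in> ?B" if "b \<in> ?B" "c \<in> ?B" for b c
    proof -
      from that obtain y z where yz: "y \<in> T (n - 1) j" "z \<in> T (n - 1) j"
        "b = cdiff I (n - 1) j y" "c = cdiff I (n - 1) j z" by blast
      then show ?thesis using d_pred_add[OF Te Te, OF yz(1,2)] Tadd[OF yz(1,2)] by (metis image_eqI)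
    qed
    show "\<ominus>\<^bsub>gcomp (cob I n) j\<^esub> b \<in> ?B" if "b \<in> ?B" for b
    proof -
      from that obtain z where z: "z \<in> T (n - 1) j" "b = cdiff I (n - 1) j z" by blast
      have "\<ominus>\<^bsub>gcomp (cob I n) j\<^esub> b = cdiff I (n - 1) j (\<ominus>\<^bsub>gcomp (cob I (n - 1)) j\<^esub> z)"
        using d_neg[OF Te[OF z(1)]] z(2) by simp
      then show ?thesis using Tneg[OF z(1)] by blast
    qed
    show "x \<in> el (cob I n) j" using Te[OF x] .
  qed
  have mem: "x \<in> ?B \<longleftrightarrow> (\<exists>z\<in>T (n - 1) j. cdiff I (n - 1) j z = x)" for x by blast
  show ?thesis unfolding exact_at_def by (rule ball_cong[OF refl]) (simp only: translate mem)
qed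

lemma subgroups_tors: "subgroups tors"
  unfolding subgroups_def
proof (intro allI conjI ballI)
  fix n j
  show "tors n j \<subseteq> el (cob I n) j" using tors_el by blast
  show "\<zero>\<^bsub>gcomp (cob I n) j\<^esub> \<in> tors n j" by (rule zero_tors)
  fix x assume x: "x \<in> tors n j"
  show "\<ominus>\<^bsub>gcomp (cob I n) j\<^esub> x \<in> tors n j"
    by (rule tors_mono[OF x _ M.ann_neg[OF tors_el[OF x]]]) (use tors_el[OF x] in simp)
qed (rule tors_add)

lemma subgroups_socle: "subgroups socle"
  unfolding subgroups_def
proof (intro allI conjI ballI)
  fix n j
  show "socle n j \<subseteq> el (cob I n) j" by (auto simp: socle_def)
  show "\<zero>\<^bsub>gcomp (cob I n) j\<^esub> \<in> socle n j" by (simp add: socle_def)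
  fix x assume x: "x \<in> socle n j"
  show "\<ominus>\<^bsub>gcomp (cob I n) j\<^esub> x \<in> socle n j"
    using x M.ann_neg[of x n j] unfolding socle_def by auto
  fix y assume y: "y \<in> socle n j"
  have e: "x \<in> el (cob I n) j" "y \<in> el (cob I n) j" using x y by (auto simp: socle_def)
  show "x \<oplus>\<^bsub>gcomp (cob I n) j\<^esub> y \<in> socle n j"
    using x y M.ann_add[OF e] e unfolding socle_def by blast
qed

lemma cohom_torsion_trivial_iff:
  "el (cohom (torsion_cpx (gpart A) I) n) j = {\<zero>\<^bsub>gcomp (cohom (torsion_cpx (gpart A) I) n) j\<^esub>}
    \<longleftrightarrow> exact_at tors n j"
proof -
  let ?X = "torsion_cpx (gpart A) I"
  have Z: "cocycles ?X n j = {x \<in> tors n j. cdiff I n j x = \<zero>\<^bsub>gcomp (cob I (n + 1)) j\<^esub>}"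
    by (auto simp: cocycles_def torsion_cpx_def gsub_def)
  have B: "coboundaries ?X n j = cdiff I (n - 1) j ` tors (n - 1) j"
    by (auto simp: coboundaries_def torsion_cpx_def gsub_def)
  have "\<zero>\<^bsub>gcomp (cob I n) j\<^esub> \<in> cocycles ?X n j"
    unfolding Z using zero_tors by simp
  then have "cocycles ?X n j \<noteq> {}" by blast
  moreover have "add (gcomp (cob ?X n) j) = add (gcomp (cob I n) j)"
    by (simp add: torsion_cpx_def gsub_def)
  ultimately have "el (cohom ?X n) j = {\<zero>\<^bsub>gcomp (cohom ?X n) j\<^esub>} \<longleftrightarrow>
      (\<forall>x\<in>{x \<in> tors n j. cdiff I n j x = \<zero>\<^bsub>gcomp (cob I (n + 1)) j\<^esub>}.
        (\<lambda>b. b \<oplus>\<^bsub>gcomp (cob I n) j\<^esub> x) ` cdiff I (n - 1) j ` tors (n - 1) j = cdiff I (n - 1) j ` tors (n - 1) j)"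
    using cohom_trivial_iff[of ?X n j] unfolding Z B by simp
  also have "\<dots> \<longleftrightarrow> exact_at tors n j"
    unfolding exact_at_iff_translate[OF subgroups_tors] by (simp only: Ball_def mem_Collect_eq imp_conjL)
  finally show ?thesis .
qed

text \<open>The cochain sending the class of 1 to \<open>x\<close>. The components of
  \<open>S\<close> are zero off \<open>p = 0\<close>, \<open>m = 0\<close>, and there the coset is a
  singleton {a}, from which \<open>the_elem\<close> recovers a.\<close>

definition hom_of_socle :: "int \<Rightarrow> int \<Rightarrow> ('a, 'x) res \<Rightarrow> int \<Rightarrow> int \<Rightarrow> 'a set \<Rightarrow> ('a, 'x) res" where
  "hom_of_socle n j x = (\<lambda>p m. \<lambda>C\<in>el (cob (stalk S) p) m.
     if p = 0 \<and> m = 0 then gact (cob I n) 0 j (the_elem C) x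
     else \<zero>\<^bsub>gcomp (cob I (p + n)) (m + j)\<^esub>)"

definition homs :: "int \<Rightarrow> int \<Rightarrow> (int \<Rightarrow> int \<Rightarrow> 'a set \<Rightarrow> ('a, 'x) res) set" where
  "homs n j = {f. \<forall>p. f p \<in> ghom (gpart A) (cob (stalk S) p) (shift j (cob I (p + n)))}"

lemma stalk_el_nonzero: "p \<noteq> 0 \<or> m \<noteq> 0 \<Longrightarrow> el (cob (stalk S) p) m = {S_zero m}"
  by (auto simp: stalk_el S_el)

lemma stalk_el_zero: "el (cob (stalk S) 0) 0 = (\<lambda>a. {a}) ` gpart A 0"
  by (simp add: stalk_el S_el)

lemma S_zero_stalk [simp]: "S_zero m \<in> el (cob (stalk S) p) m"
  by (simp add: stalk_el)

lemma hom_of_socle_nonzero: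
  "p \<noteq> 0 \<or> m \<noteq> 0 \<Longrightarrow> C \<in> el (cob (stalk S) p) m \<Longrightarrow>
    hom_of_socle n j x p m C = \<zero>\<^bsub>gcomp (cob I (p + n)) (m + j)\<^esub>"
  by (auto simp: hom_of_socle_def)

lemma hom_of_socle_S_zero:
  "x \<in> el (cob I n) j \<Longrightarrow>
    hom_of_socle n j x p m (S_zero m) = \<zero>\<^bsub>gcomp (cob I (p + n)) (m + j)\<^esub>"
  by (auto simp: hom_of_socle_def) (simp add: S_zero_def)

lemma hom_of_socle_zero:
  "a \<in> gpart A 0 \<Longrightarrow> hom_of_socle n j x 0 0 {a} = gact (cob I n) 0 j a x"
  by (simp add: hom_of_socle_def stalk_el_zero)

text \<open>The essential check is linearity for a of positive degree on the class of b in degree 0: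
  the product is zero in \<open>S\<close>, and a b x = 0 because x is in the socle.\<close>

lemma hom_of_socle_homs:
  assumes x: "x \<in> socle n j"
  shows "hom_of_socle n j x \<in> homs n j"
  unfolding homs_def ghom_def
proof (intro CollectI allI conjI IntI ballI)
  fix p m
  let ?f = "hom_of_socle n j x"
  have xe: "x \<in> el (cob I n) j" using x by (simp add: socle_def)
  show "?f p m \<in> extensional (el (cob (stalk S) p) m)" by (simp add: hom_of_socle_def)
  show "?f p m \<in> hom (add_monoid (gcomp (cob (stalk S) p) m)) (add_monoid (gcomp (shift j (cob I (p + n))) m))"
  proof (cases "p = 0 \<and> m = 0")
    case True
    show ?thesis
    proof (rule homI)
      fix C assume "C \<in> carrier (add_monoid (gcomp (cob (stalk S) p) m))"
      then obtain a where a: "a \<in> gpart A 0" "C = {a}" using True stalk_el_zero by auto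
      then show "?f p m C \<in> carrier (add_monoid (gcomp (shift j (cob I (p + n))) m))"
        using True M.act_closed[OF a(1) xe] by (simp add: shift_def hom_of_socle_zero)
      fix D assume "D \<in> carrier (add_monoid (gcomp (cob (stalk S) p) m))"
      then obtain b where b: "b \<in> gpart A 0" "D = {b}" using True stalk_el_zero by auto
      show "?f p m (C \<otimes>\<^bsub>add_monoid (gcomp (cob (stalk S) p) m)\<^esub> D)
          = ?f p m C \<otimes>\<^bsub>add_monoid (gcomp (shift j (cob I (p + n))) m)\<^esub> ?f p m D"
        using True a b M.act_ladd[OF a(1) b(1) xe]
        by (simp add: shift_def hom_of_socle_zero stalk_add S_add)
    qed
  next
    case False
    then have "el (cob (stalk S) p) m = {S_zero m}" by (intro stalk_el_nonzero) auto
    then show ?thesis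
      by (intro homI) (auto simp: shift_def hom_of_socle_S_zero[OF xe] stalk_add S_zero_add_zero)
  qed
  fix i a C
  assume a: "a \<in> gpart A i" and C: "C \<in> el (cob (stalk S) p) m"
  show "?f p (m + int i) (gact (cob (stalk S) p) i m a C) = gact (shift j (cob I (p + n))) i m a (?f p m C)"
  proof (cases "p = 0 \<and> m = 0")
    case True
    then obtain b where b: "b \<in> gpart A 0" "C = {b}" using C stalk_el_zero by auto
    have ab: "gact (cob I n) i j a (gact (cob I n) 0 j b x) = gact (cob I n) i j (a \<otimes> b) x"
      using M.act_mult[OF a b(1) xe] by simp
    show ?thesis
    proof (cases "i = 0")
      case True
      then show ?thesis using \<open>p = 0 \<and> m = 0\<close> a b ab
        by (simp add: shift_def stalk_act S_act_degree_zero hom_of_socle_zero gpart_mult_zero)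
    next
      case False
      have "a \<otimes> b \<in> M.ann n j x i" using x False gpart_mult[OF a b(1)] by (auto simp: socle_def)
      then have "gact (cob I n) i j (a \<otimes> b) x = \<zero>\<^bsub>gcomp (cob I n) (j + int i)\<^esub>" by (rule M.annD)
      moreover have "gact S i 0 a C = S_zero (int i)"
        using S_act_pos[OF a, of C 0] False C True by (simp add: stalk_el)
      ultimately show ?thesis using \<open>p = 0 \<and> m = 0\<close> b ab hom_of_socle_S_zero[OF xe, of 0 "int i"]
        by (simp add: shift_def stalk_act hom_of_socle_zero add.commute)
    qed
  next
    case False
    then have "C = S_zero m" using C stalk_el_nonzero by blast
    then show ?thesis using a xe
      by (simp add: stalk_act S_act_zero hom_of_socle_S_zero shift_def ac_simps)
  qed
qed

text \<open>\<open>S\<close> is generated by the class of 1, so a map is determined by the image x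
  of that class. Elements of positive degree send the class to zero, hence kill x.\<close>

lemma homs_eq: "homs n j = hom_of_socle n j ` socle n j"
proof
  show "hom_of_socle n j ` socle n j \<subseteq> homs n j" using hom_of_socle_homs by blast
  show "homs n j \<subseteq> hom_of_socle n j ` socle n j"
  proof
    fix f assume f: "f \<in> homs n j"
    have exten: "f p m \<in> extensional (el (cob (stalk S) p) m)"
      and hom: "f p m \<in> hom (add_monoid (gcomp (cob (stalk S) p) m)) (add_monoid (gcomp (cob I (p + n)) (m + j)))"
      and act: "a \<in> gpart A i \<Longrightarrow> C \<in> el (cob (stalk S) p) m \<Longrightarrow>
        f p (m + int i) (gact S i m a C) = gact (cob I (p + n)) i (m + j) a (f p m C)" for p m i a C
      using f by (auto simp: homs_def ghom_def shift_def stalk_act)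
    have closed: "f p m C \<in> el (cob I (p + n)) (m + j)" if "C \<in> el (cob (stalk S) p) m" for p m C
      using hom_in_carrier[OF hom] that by simp
    have zero: "f p m (S_zero m) = \<zero>\<^bsub>gcomp (cob I (p + n)) (m + j)\<^esub>" for p m
      using hom_mult[OF hom, of "S_zero m" p m "S_zero m"] closed[OF S_zero_stalk, of p m]
      by (simp add: stalk_add S_zero_add_zero M.G.add.l_cancel_one)
    have one: "{\<one>} \<in> el (cob (stalk S) 0) 0" by (simp add: stalk_el_zero)
    define x where "x = f 0 0 {\<one>}"
    have xe: "x \<in> el (cob I n) j" using closed[OF one] by (simp add: x_def)
    have x: "x \<in> socle n j"
      unfolding socle_def
    proof (intro CollectI conjI allI impI subsetI)
      fix i :: nat and a assume i: "i > 0" and a: "a \<in> gpart A i"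
      have "{\<one>} \<in> el S 0" using one by (simp add: stalk_el)
      then have "gact (cob I n) i j a x = f 0 (int i) (S_zero (int i))"
        using act[OF a one] S_act_pos[OF a i, of "{\<one>}" 0] by (simp add: x_def)
      then show "a \<in> M.ann n j x i" using zero[of 0 "int i"] a by (intro M.annI) (simp_all add: ac_simps)
    qed (rule xe)
    have "f p m C = hom_of_socle n j x p m C" for p m C
    proof (cases "C \<in> el (cob (stalk S) p) m")
      case False
      then show ?thesis using exten[of p m] by (simp add: extensional_def hom_of_socle_def)
    next
      case C: True
      show ?thesis
      proof (cases "p = 0 \<and> m = 0")
        case True
        then obtain a where a: "a \<in> gpart A 0" "C = {a}" using C stalk_el_zero by auto
        then show ?thesis using True act[OF a(1) one] gpart_carrier[OF a(1)]
          by (simp add: S_act_degree_zero hom_of_socle_zero x_def)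
      next
        case False
        then have "C = S_zero m" using C stalk_el_nonzero by blast
        then show ?thesis by (simp add: zero hom_of_socle_S_zero[OF xe])
      qed
    qed
    then have "f = hom_of_socle n j x" by (intro ext) auto
    then show "f \<in> hom_of_socle n j ` socle n j" using x by blast
  qed
qed

lemma hom_of_socle_inj:
  assumes "x \<in> el (cob I n) j" "y \<in> el (cob I n) j" "hom_of_socle n j x = hom_of_socle n j y"
  shows "x = y"
proof -
  have "gact (cob I n) 0 j \<one> x = hom_of_socle n j x 0 0 {\<one>}"
    by (rule hom_of_socle_zero[OF gpart_one, symmetric])
  also have "\<dots> = gact (cob I n) 0 j \<one> y"
    unfolding assms(3) by (rule hom_of_socle_zero[OF gpart_one])
  finally show ?thesis using assms(1,2) by simp
qed

abbreviation "HomC \<equiv> plain_hom_cpx (gpart A) (stalk S) I"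

lemma HomC_el: "el (cob HomC n) j = homs n j"
  by (simp add: plain_hom_cpx_def hom_cpx_def homs_def)

lemma HomC_add:
  assumes "x \<in> el (cob I n) j" "y \<in> el (cob I n) j"
  shows "hom_of_socle n j x \<oplus>\<^bsub>gcomp (cob HomC n) j\<^esub> hom_of_socle n j y
    = hom_of_socle n j (x \<oplus>\<^bsub>gcomp (cob I n) j\<^esub> y)"
proof (rule ext, rule ext, rule ext)
  fix p m C
  have 1: "gact (cob I n) 0 j a (x \<oplus>\<^bsub>gcomp (cob I n) j\<^esub> y)
      = gact (cob I n) 0 j a x \<oplus>\<^bsub>gcomp (cob I n) j\<^esub> gact (cob I n) 0 j a y" if "a \<in> gpart A 0" for a
    using M.act_add[OF that assms] by simp
  show "(hom_of_socle n j x \<oplus>\<^bsub>gcomp (cob HomC n) j\<^esub> hom_of_socle n j y) p m C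
    = hom_of_socle n j (x \<oplus>\<^bsub>gcomp (cob I n) j\<^esub> y) p m C"
    by (auto simp: plain_hom_cpx_def hom_cpx_def hom_of_socle_def stalk_el_zero 1)
qed

text \<open>The differential of \<open>stalk S\<close> is zero, so the term f d of the Hom
  differential vanishes whatever its sign, and d f remains.\<close>

lemma HomC_diff:
  assumes x: "x \<in> el (cob I n) j"
  shows "cdiff HomC n j (hom_of_socle n j x) = hom_of_socle (n + 1) j (cdiff I n j x)"
proof (rule ext, rule ext, rule ext)
  fix p m C
  show "cdiff HomC n j (hom_of_socle n j x) p m C = hom_of_socle (n + 1) j (cdiff I n j x) p m C"
  proof (cases "C \<in> el (cob (stalk S) p) m")
    case False
    then show ?thesis by (simp add: plain_hom_cpx_def hom_cpx_def hom_of_socle_def)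
  next
    case C: True
    have idx: "p + 1 + n = p + n + 1" "p + (n + 1) = p + n + 1" by simp_all
    have v: "hom_of_socle n j x (p + 1) m (cdiff (stalk S) p m C) = \<zero>\<^bsub>gcomp (cob I (p + n + 1)) (m + j)\<^esub>"
      using hom_of_socle_S_zero[OF x, of "p + 1" m] stalk_diff[OF C] by (simp add: idx)
    have u: "cdiff I (p + n) (m + j) (hom_of_socle n j x p m C) = hom_of_socle (n + 1) j (cdiff I n j x) p m C"
    proof (cases "p = 0 \<and> m = 0")
      case True
      then obtain a where a: "a \<in> gpart A 0" "C = {a}" using C stalk_el_zero by auto
      then show ?thesis using True d_act[OF a(1) x] by (simp add: hom_of_socle_zero)
    next
      case False
      then show ?thesis using C by (simp add: hom_of_socle_nonzero idx)
    qed
    have "hom_of_socle n j x p m C \<in> el (cob I (p + n)) (m + j)"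
    proof (cases "p = 0 \<and> m = 0")
      case True
      then obtain a where a: "a \<in> gpart A 0" "C = {a}" using C stalk_el_zero by auto
      then show ?thesis using True M.act_closed[OF a(1) x] by (simp add: hom_of_socle_zero)
    next
      case False
      then show ?thesis using C by (simp add: hom_of_socle_nonzero)
    qed
    then have "cdiff I (p + n) (m + j) (hom_of_socle n j x p m C) \<in> el (cob I (p + n + 1)) (m + j)" by simp
    then have "cdiff HomC n j (hom_of_socle n j x) p m C = cdiff I (p + n) (m + j) (hom_of_socle n j x p m C)"
      using C v by (simp add: plain_hom_cpx_def hom_cpx_def a_minus_def Let_def)
    then show ?thesis using u by simp
  qed
qed

lemma HomC_zero: "\<zero>\<^bsub>gcomp (cob HomC n) j\<^esub> = hom_of_socle n j \<zero>\<^bsub>gcomp (cob I n) j\<^esub>"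
proof (rule ext, rule ext, rule ext)
  fix p m C
  have 1: "gact (cob I n) 0 j a \<zero>\<^bsub>gcomp (cob I n) j\<^esub> = \<zero>\<^bsub>gcomp (cob I n) j\<^esub>" if "a \<in> gpart A 0" for a
    using M.act_zero[OF that, of n j] by simp
  show "\<zero>\<^bsub>gcomp (cob HomC n) j\<^esub> p m C = hom_of_socle n j \<zero>\<^bsub>gcomp (cob I n) j\<^esub> p m C"
    by (auto simp: plain_hom_cpx_def hom_cpx_def hom_of_socle_def stalk_el_zero 1)
qed

text \<open>\<open>hom_of_socle\<close> is injective, additive and compatible with the
  differentials, so an equality of translates of coboundaries in the Hom complex is the image of the
  same equality in the socle complex.\<close>

lemma cohom_HomC_trivial_iff:
  "el (cohom HomC n) j = {\<zero>\<^bsub>gcomp (cohom HomC n) j\<^esub>} \<longleftrightarrow> exact_at socle n j"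
proof -
  let ?h = "hom_of_socle n j"
  let ?B = "cdiff I (n - 1) j ` socle (n - 1) j"
  have se: "x \<in> el (cob I n) j" if "x \<in> socle n j" for x n using that by (simp add: socle_def)
  have inj: "inj_on ?h (el (cob I n) j)" using hom_of_socle_inj by (auto intro: inj_onI)
  let ?Z = "{x \<in> socle n j. cdiff I n j x = \<zero>\<^bsub>gcomp (cob I (n + 1)) j\<^esub>}"
  have Z: "cocycles HomC n j = ?h ` ?Z"
  proof -
    have "cdiff HomC n j (?h x) = \<zero>\<^bsub>gcomp (cob HomC (n + 1)) j\<^esub> \<longleftrightarrow>
        cdiff I n j x = \<zero>\<^bsub>gcomp (cob I (n + 1)) j\<^esub>" if "x \<in> socle n j" for x
      using hom_of_socle_inj[of "cdiff I n j x" "n + 1" j "\<zero>\<^bsub>gcomp (cob I (n + 1)) j\<^esub>"] se[OF that]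
      by (auto simp: HomC_diff HomC_zero)
    then show ?thesis unfolding cocycles_def HomC_el homs_eq by blast
  qed
  have B: "coboundaries HomC n j = ?h ` ?B"
  proof -
    have "cdiff HomC (n - 1) j ` homs (n - 1) j
        = (\<lambda>x. cdiff HomC (n - 1) j (hom_of_socle (n - 1) j x)) ` socle (n - 1) j"
      by (simp add: homs_eq image_image)
    also have "\<dots> = (\<lambda>x. ?h (cdiff I (n - 1) j x)) ` socle (n - 1) j"
      by (rule image_cong[OF refl]) (simp add: HomC_diff[OF se])
    finally show ?thesis unfolding coboundaries_def HomC_el by (simp add: image_image)
  qed
  have BI: "?B \<subseteq> el (cob I n) j" using se by auto
  have translate: "(\<lambda>b. b \<oplus>\<^bsub>gcomp (cob HomC n) j\<^esub> ?h x) ` ?h ` ?B = ?h ` ?B \<longleftrightarrow>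
      (\<lambda>b. b \<oplus>\<^bsub>gcomp (cob I n) j\<^esub> x) ` ?B = ?B" if x: "x \<in> socle n j" for x
  proof -
    have "(\<lambda>b. b \<oplus>\<^bsub>gcomp (cob HomC n) j\<^esub> ?h x) ` ?h ` ?B = ?h ` (\<lambda>b. b \<oplus>\<^bsub>gcomp (cob I n) j\<^esub> x) ` ?B"
      unfolding image_image
      by (rule image_cong[OF refl]) (rule HomC_add[OF subsetD[OF BI imageI] se[OF x]])
    moreover have "(\<lambda>b. b \<oplus>\<^bsub>gcomp (cob I n) j\<^esub> x) ` ?B \<subseteq> el (cob I n) j" using BI se[OF x] by auto
    ultimately show ?thesis using inj_on_image_eq_iff[OF inj] BI by metis
  qed
  have "\<zero>\<^bsub>gcomp (cob I n) j\<^esub> \<in> socle n j" using subgroups_socle by (simp add: subgroups_def)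
  then have "cocycles HomC n j \<noteq> {}" unfolding Z using d_zero by blast
  then have "el (cohom HomC n) j = {\<zero>\<^bsub>gcomp (cohom HomC n) j\<^esub>} \<longleftrightarrow>
      (\<forall>x\<in>?h ` ?Z. (\<lambda>b. b \<oplus>\<^bsub>gcomp (cob HomC n) j\<^esub> x) ` ?h ` ?B = ?h ` ?B)"
    using cohom_trivial_iff[of HomC n j] unfolding Z B by simp
  also have "\<dots> \<longleftrightarrow> (\<forall>x\<in>?Z. (\<lambda>b. b \<oplus>\<^bsub>gcomp (cob HomC n) j\<^esub> ?h x) ` ?h ` ?B = ?h ` ?B)"
    by (simp only: ball_simps)
  also have "\<dots> \<longleftrightarrow> (\<forall>x\<in>?Z. (\<lambda>b. b \<oplus>\<^bsub>gcomp (cob I n) j\<^esub> x) ` ?B = ?B)"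
    by (rule ball_cong[OF refl]) (rule translate, simp)
  also have "\<dots> \<longleftrightarrow> exact_at socle n j"
    unfolding exact_at_iff_translate[OF subgroups_socle] by (simp only: Ball_def mem_Collect_eq imp_conjL)
  finally show ?thesis .
qed

lemma sup_deg_eq: "sup_deg (torsion_cpx (gpart A) I) = sup_deg HomC"
proof (rule antisym)
  show "sup_deg (torsion_cpx (gpart A) I) \<le> sup_deg HomC"
  proof (rule sup_deg_le, unfold cohom_HomC_trivial_iff cohom_torsion_trivial_iff)
    fix q i j assume "\<And>i j. i + j \<ge> q \<Longrightarrow> exact_at socle i j" "i + j \<ge> q"
    then show "exact_at tors i j" using tors_exact[of q] unfolding exact_from_def by blast
  qed
  show "sup_deg HomC \<le> sup_deg (torsion_cpx (gpart A) I)"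
  proof (rule sup_deg_le, unfold cohom_HomC_trivial_iff cohom_torsion_trivial_iff)
    fix q i j assume "\<And>i j. i + j \<ge> q \<Longrightarrow> exact_at tors i j" "i + j \<ge> q"
    then show "exact_at socle i j" using socle_exact[of q] unfolding exact_from_def by blast
  qed
qed

end

theorem theorem1p3:
  fixes K :: "'k ring" and A :: "('k, 'a) gralg"
    and R :: "('a + 'a, 'r) cpx" and X :: "('a, 'x) cpx"
  assumes "graded_algebra K A" and "locally_finite K A"
    and "left_noetherian A" and "left_noetherian (opp A)"
    and "semisimple_ring (A\<lparr>carrier := gpart A 0\<rparr>)"
    and "balanced_dualizing_complex K A R"
    and "Dplus_fg A X" and "\<not> acyclic_cpx X"
  shows "CMreg A X = Ex_reg A X"
proof -
  obtain c0 c1 :: 'x where two: "c0 \<noteq> c1"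
    using two_elements_if_not_acyclic[of "gpart A" A X] assms(7,8) by (auto simp: Dplus_fg_def)
  have eq: "sup_deg (torsion_cpx (gpart A) I) = sup_deg (plain_hom_cpx (gpart A) (stalk (S_mod A)) I)"
    if "inj_resolution (gpart A) (graded_module A) X I \<eta>" for I :: "('a, ('a, 'x) res) cpx" and \<eta>
  proof -
    have I: "gr_complex (gpart A) (graded_module A) I" "bounded_below I"
        "\<And>n. injective_obj (gpart A) (graded_module A) (cob I n)"
      using that by (simp_all add: inj_resolution_def)
    have "inj_cpx K A I c0 c1"
      by (intro inj_cpx.intro semisimple_gr_alg.intro gr_alg.intro semisimple_gr_alg_axioms.intro
          inj_cpx_axioms.intro assms(1,3,5) I two)
    then show ?thesis by (rule inj_cpx.sup_deg_eq)
  qed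
  \<comment> \<open>Both regularities are suprema indexed by the same injective resolutions of X,
    and \<open>eq\<close> makes them agree term by term.\<close>
  show ?thesis
  proof (rule antisym)
    show "CMreg A X \<le> Ex_reg A X"
      unfolding CMreg_def
    proof (rule SUP_least)
      fix Y assume "Y \<in> RGamma A X"
      then have "\<exists>I \<eta>. Y = torsion_cpx (gpart A) I \<and> inj_resolution (gpart A) (graded_module A) X I \<eta>"
        unfolding RGamma_def mem_Collect_eq .
      then obtain I \<eta> where I: "inj_resolution (gpart A) (graded_module A) X I \<eta>"
        "Y = torsion_cpx (gpart A) I" by (elim exE conjE)
      have "plain_hom_cpx (gpart A) (stalk (S_mod A)) I \<in> RHom A (stalk (S_mod A)) X"
        unfolding RHom_def mem_Collect_eq by (rule exI[of _ I], rule exI[of _ \<eta>], rule conjI[OF refl I(1)])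
      then show "sup_deg Y \<le> Ex_reg A X"
        unfolding Ex_reg_def I(2) eq[OF I(1)] by (rule SUP_upper)
    qed
    show "Ex_reg A X \<le> CMreg A X"
      unfolding Ex_reg_def
    proof (rule SUP_least)
      fix Y assume "Y \<in> RHom A (stalk (S_mod A)) X"
      then have "\<exists>I \<eta>. Y = plain_hom_cpx (gpart A) (stalk (S_mod A)) I \<and>
          inj_resolution (gpart A) (graded_module A) X I \<eta>"
        unfolding RHom_def mem_Collect_eq .
      then obtain I \<eta> where I: "inj_resolution (gpart A) (graded_module A) X I \<eta>"
        "Y = plain_hom_cpx (gpart A) (stalk (S_mod A)) I" by (elim exE conjE)
      have "torsion_cpx (gpart A) I \<in> RGamma A X"
        unfolding RGamma_def mem_Collect_eq by (rule exI[of _ I], rule exI[of _ \<eta>], rule conjI[OF refl I(1)])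
      then show "sup_deg Y \<le> CMreg A X"
        unfolding CMreg_def I(2) eq[OF I(1), symmetric] by (rule SUP_upper)
    qed
  qed
qed

end
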